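(* There are absolute constants $\epsilon_0>0$ and $c>0$ such that for every integer $n\ge2$ and all $0<\epsilon<\epsilon_0$, the class $\mathcal{L}_n$ of halfspaces over the Boolean hypercube $\{\pm1\}^n$ satisfies $$m^{\mathrm{test}}_\epsilon(\mathcal{L}_n)\ge c\cdot\frac{n}{\log n}\qquad\text{and}\qquad q^{\mathrm{test}}_{0,\epsilon}(\mathcal{L}_n)\ge c\cdot\frac{n}{\log n}.$$
   Context: Here $\mathcal{L}_n$ is the set of functions $f:\{\pm1\}^n\to\{\pm1\}$ of the form $f(x)=\mathrm{sign}(w_0+\sum_{i=1}^n w_ix_i)$ with $w_0,\dots,w_n\in\mathbb{R}$, where $\mathrm{sign}(z)=1$ for $z\ge0$ and $-1$ otherwise. For a class $\mathcal{H}$ of two-valued functions on $\mathcal{X}$ and a probability distribution $\mathcal{D}$ on $\mathcal{X}$, $\mathrm{dist}_{\mathcal{D}}(f,g)=\Pr_{x\sim\mathcal{D}}[f(x)\ne g(x)]$ and $\mathrm{dist}_{\mathcal{D}}(f,\mathcal{H})=\inf_{h\in\mathcal{H}}\mathrm{dist}_{\mathcal{D}}(f,h)$. All testers are computationally unbounded randomized algorithms that must work for every unknown distribution $\mathcal{D}$ on $\mathcal{X}$ and every unknown two-valued function $f$ on $\mathcal{X}$. (i) $m^{\mathrm{test}}_\epsilon(\mathcal{H})$ is the minimum $m$ such that some algorithm receiving $m$ labelled examples $(x,f(x))$, $x\sim\mathcal{D}$ independently, accepts with probability $\ge 2/3$ if $f\in\mathcal{H}$ and rejects with probability $\ge2/3$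 if $\mathrm{dist}_{\mathcal{D}}(f,\mathcal{H})\ge\epsilon$. (ii) $q^{\mathrm{test}}_{0,\epsilon}(\mathcal{H})$ is the minimum $q$ such that some algorithm making in total at most $q$ adaptive queries to $f$ at arbitrary points of $\mathcal{X}$ and independent labelled samples $(x,f(x))$, $x\sim\mathcal{D}$, accepts with probability $\ge2/3$ if $\mathrm{dist}_{\mathcal{D}}(f,\mathcal{H})=0$ and rejects with probability $\ge2/3$ if $\mathrm{dist}_{\mathcal{D}}(f,\mathcal{H})\ge\epsilon$. *)

theory Defs
  imports "HOL-Probability.Probability"
begin

definition cube :: "nat \<Rightarrow> (nat \<Rightarrow> real) set" where
  "cube n = {1..n} \<rightarrow>\<^sub>E {-1, 1}"

text \<open>Unlike \<^const>\<open>sgn\<close>, the sign of zero is one.\<close>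

definition sign_pm :: "real \<Rightarrow> real" where
  "sign_pm z = (if z \<ge> 0 then 1 else -1)"

definition halfspaces :: "nat \<Rightarrow> ((nat \<Rightarrow> real) \<Rightarrow> real) set" where
  "halfspaces n =
     {f. \<exists>w :: nat \<Rightarrow> real. f = (\<lambda>x\<in>cube n. sign_pm (w 0 + (\<Sum>i=1..n. w i * x i)))}"

text \<open>
  Distributions on a domain \<open>X\<close> are probability mass functions supported in \<open>X\<close>. For finite \<open>X\<close>,
  such as the hypercube, these are all the probability distributions on \<open>X\<close>. Two-valued functions
  on \<open>X\<close> are the elements of \<open>X \<rightarrow>\<^sub>E {-1, 1}\<close>.
\<close>

definition dist_fun :: "'a pmf \<Rightarrow> ('a \<Rightarrow> real) \<Rightarrow> ('a \<Rightarrow> real) \<Rightarrow> real" where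
  "dist_fun D f g = measure_pmf.prob D {x. f x \<noteq> g x}"

definition dist_class :: "'a pmf \<Rightarrow> ('a \<Rightarrow> real) \<Rightarrow> ('a \<Rightarrow> real) set \<Rightarrow> real" where
  "dist_class D f H = (INF h\<in>H. dist_fun D f h)"


section \<open>Sample-based testers\<close>

text \<open>
  A computationally unbounded randomized algorithm on labelled samples is a map from lists of
  labelled examples to distributions of its verdict, \<^const>\<open>True\<close> meaning acceptance.
\<close>

type_synonym 'a sample_tester = "('a \<times> real) list \<Rightarrow> bool pmf"

definition run_sample_tester ::
    "nat \<Rightarrow> 'a sample_tester \<Rightarrow> 'a pmf \<Rightarrow> ('a \<Rightarrow> real) \<Rightarrow> bool pmf" where
  "run_sample_tester m T D f =
     bind_pmf (replicate_pmf m D) (\<lambda>xs. T (map (\<lambda>x. (x, f x)) xs))"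

definition is_sample_tester ::
    "'a set \<Rightarrow> ('a \<Rightarrow> real) set \<Rightarrow> real \<Rightarrow> nat \<Rightarrow> 'a sample_tester \<Rightarrow> bool" where
  "is_sample_tester X H \<epsilon> m T \<longleftrightarrow>
     (\<forall>D f. set_pmf D \<subseteq> X \<longrightarrow> f \<in> X \<rightarrow>\<^sub>E {-1, 1} \<longrightarrow>
        (f \<in> H \<longrightarrow> pmf (run_sample_tester m T D f) True \<ge> 2/3) \<and>
        (dist_class D f H \<ge> \<epsilon> \<longrightarrow> pmf (run_sample_tester m T D f) False \<ge> 2/3))"

text \<open>The minimum is taken in \<^typ>\<open>enat\<close>, so that it is infinite if no tester exists.\<close>

definition m_test :: "'a set \<Rightarrow> ('a \<Rightarrow> real) set \<Rightarrow> real \<Rightarrow> enat" where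
  "m_test X H \<epsilon> = Inf {enat m | m. \<exists>T. is_sample_tester X H \<epsilon> m T}"


section \<open>Testers with queries and samples\<close>

text \<open>
  An adaptive algorithm is a tree: it may stop with a verdict, query the label of a point, draw a
  labelled sample, or use internal randomness, and continues depending on the outcome.
\<close>

datatype 'a query_tester =
    Verdict bool
  | Query 'a "real \<Rightarrow> 'a query_tester"
  | Sample "'a \<Rightarrow> real \<Rightarrow> 'a query_tester"
  | Toss "'a query_tester pmf"

primrec run_query_tester ::
    "'a query_tester \<Rightarrow> 'a pmf \<Rightarrow> ('a \<Rightarrow> real) \<Rightarrow> bool pmf" where
  "run_query_tester (Verdict b) = (\<lambda>D f. return_pmf b)"
| "run_query_tester (Query x k) = (\<lambda>D f. run_query_tester (k (f x)) D f)"
| "run_query_tester (Sample k) = (\<lambda>D f. bind_pmf D (\<lambda>x. run_query_tester (k x (f x)) D f))"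
| "run_query_tester (Toss p) =
     (\<lambda>D f. bind_pmf (map_pmf run_query_tester p) (\<lambda>r. r D f))"

text \<open>
  Along every path of the tree, for all points of \<open>X\<close> and labels \<open>-1, 1\<close> it may be given as
  answers, at most \<open>q\<close> queries and samples are made in total, and all queries are in \<open>X\<close>. Paths
  with mutually inconsistent answers are also counted; they can be pruned from the tree without
  changing its behaviour, so this does not affect the minimum below.
\<close>

inductive cost_at_most :: "'a set \<Rightarrow> nat \<Rightarrow> 'a query_tester \<Rightarrow> bool" for X where
  "cost_at_most X q (Verdict b)"
| "x \<in> X \<Longrightarrow> (\<And>y. y \<in> {-1, 1} \<Longrightarrow> cost_at_most X q (k y)) \<Longrightarrow>
     cost_at_most X (Suc q) (Query x k)"
| "(\<And>x y. x \<in> X \<Longrightarrow> y \<in> {-1, 1} \<Longrightarrow> cost_at_most X q (k x y)) \<Longrightarrow>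
     cost_at_most X (Suc q) (Sample k)"
| "(\<And>t. t \<in> set_pmf p \<Longrightarrow> cost_at_most X q t) \<Longrightarrow> cost_at_most X q (Toss p)"

definition is_query_tester ::
    "'a set \<Rightarrow> ('a \<Rightarrow> real) set \<Rightarrow> real \<Rightarrow> 'a query_tester \<Rightarrow> bool" where
  "is_query_tester X H \<epsilon> t \<longleftrightarrow>
     (\<forall>D f. set_pmf D \<subseteq> X \<longrightarrow> f \<in> X \<rightarrow>\<^sub>E {-1, 1} \<longrightarrow>
        (dist_class D f H = 0 \<longrightarrow> pmf (run_query_tester t D f) True \<ge> 2/3) \<and>
        (dist_class D f H \<ge> \<epsilon> \<longrightarrow> pmf (run_query_tester t D f) False \<ge> 2/3))"

definition q_test :: "'a set \<Rightarrow> ('a \<Rightarrow> real) set \<Rightarrow> real \<Rightarrow> enat" where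
  "q_test X H \<epsilon> = Inf {enat q | q. \<exists>t. cost_at_most X q t \<and> is_query_tester X H \<epsilon> t}"

end

theory Submission
  imports Defs "HOL-Real_Asymp.Real_Asymp"
begin

text \<open>
  Fix a set \<open>S\<close> of \<open>64n\<close> points of the hypercube such that every subset of at most \<open>n/16\<close> points is
  affinely independent, and a function \<open>f\<close> that differs from every halfspace on more than \<open>4n\<close>
  points of \<open>S\<close> (such \<open>f\<close> exists since halfspaces have VC dimension at most \<open>n + 1\<close>). If a distribution
  on \<open>S\<close> has few points in its support, then \<open>f\<close> agrees with a halfspace on the support; if it is
  nearly uniform, then \<open>f\<close> is far from all halfspaces. As \<open>f\<close> is the same in both cases, queries
  do not help, and the tester has to tell small from large support by sampling.

  Let the weights of the points be independent copies of a random variable \<open>U\<close> that is mostly zero,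
  or of \<open>V\<close> that is mostly a constant \<open>a > 0\<close>, where \<open>U\<close> and \<open>V\<close> take values up to \<open>r\<^sup>2\<close> and have the
  same moments up to order \<open>r\<close>, with \<open>r\<close> proportional to \<open>log n\<close>. The acceptance probability of a tester
  is a polynomial of degree \<open>q\<close> in the weight of each single point, so replacing the weights one at a
  time from \<open>U\<close> to \<open>V\<close> only changes its terms of degree above \<open>r\<close>. These are negligible unless \<open>q\<close> is at
  least of order \<open>n / log n\<close>.
\<close>

section \<open>Points in general position\<close>

text \<open>The bound n / log n comes from one balance. Weights reach B = r^2 while the normalising
  mass M is of order n, so in one replacement the uncancelled terms are of size (C q B / (r M))^r
  for a constant C. About 64n replacements must together cost less than a constant, which forces r
  of order log n; the error is then small while q is below a constant times M r / B, that is n / log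
  n. The range r^2 arises because 2r-fold differencing in j kills powers of j - r below 2r, hence
  powers of its square below r. Two things are needed beyond equal moments. Random weights do not
  sum to a fixed number, so M is fixed in advance and one point takes the leftover mass; this works
  only if totals rarely exceed M. And the mean of the weights must be O(a), not only their typical
  value: otherwise M would have to be so large that the points of weight a carry a vanishing share
  of the mass, and \<open>f\<close> would not be far from halfspaces by a constant.\<close>

lemma sum_binomial_le:
  fixes x :: real
  assumes "0 < x" "x \<le> 1"
  shows "(\<Sum>j\<le>d. real (N choose j)) * x ^ d \<le> (1 + x) ^ N"
proof -
  have "(\<Sum>j\<le>d. real (N choose j)) * x ^ d = (\<Sum>j\<le>d. real (N choose j) * x ^ d)"
    by (simp add: sum_distrib_right)
  also have "\<dots> \<le> (\<Sum>j\<le>d. real (N choose j) * x ^ j)"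
    using assms by (intro sum_mono mult_left_mono power_decreasing) auto
  also have "\<dots> \<le> (\<Sum>j\<le>max d N. real (N choose j) * x ^ j)"
    using assms by (intro sum_mono2) auto
  also have "\<dots> = (\<Sum>j\<le>N. real (N choose j) * x ^ j)"
    by (intro sum.mono_neutral_right) auto
  also have "\<dots> = (1 + x) ^ N"
    using binomial_ring[of x 1 N] by (simp add: add.commute)
  finally show ?thesis .
qed

text \<open>Exponential tilting: for indices above r, z^r is at most z^j, and the full tilted sum is
  a binomial power.\<close>

lemma sum_binomial_tail_le:
  fixes y z :: real
  assumes "0 \<le> y" "1 \<le> z"
  shows "(\<Sum>j\<in>{r<..q}. real (q choose j) * y ^ j) * z ^ r \<le> (1 + y * z) ^ q"
proof -
  have "(\<Sum>j\<in>{r<..q}. real (q choose j) * y ^ j) * z ^ r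
      = (\<Sum>j\<in>{r<..q}. real (q choose j) * y ^ j * z ^ r)"
    by (simp add: sum_distrib_right)
  also have "\<dots> \<le> (\<Sum>j\<in>{r<..q}. real (q choose j) * y ^ j * z ^ j)"
    using assms by (intro sum_mono mult_left_mono power_increasing) auto
  also have "\<dots> \<le> (\<Sum>j\<le>q. real (q choose j) * y ^ j * z ^ j)"
    using assms by (intro sum_mono2) auto
  also have "\<dots> = (1 + y * z) ^ q"
    using binomial_ring[of "y * z" 1 q]
    by (simp add: add.commute power_mult_distrib mult.assoc)
  finally show ?thesis .
qed

lemma sum_binomial_le_exp:
  fixes t :: real
  assumes "t \<ge> 1"
  shows "(\<Sum>j\<le>d. real (N choose j)) \<le> t ^ d * exp (real N / t)"
proof -
  have "(\<Sum>j\<le>d. real (N choose j)) * (1 / t) ^ d \<le> (1 + 1 / t) ^ N"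
    using assms by (intro sum_binomial_le) auto
  also have "\<dots> \<le> exp (1 / t) ^ N"
    using assms by (intro power_mono) (auto simp: add_nonneg_nonneg)
  also have "\<dots> = exp (real N / t)"
    by (simp add: exp_of_nat_mult[symmetric])
  finally show ?thesis
    using assms by (simp add: power_divide divide_simps mult.commute)
qed

lemma card_subsets_le:
  assumes "finite S"
  shows "card {W. W \<subseteq> S \<and> card W \<le> d} = (\<Sum>j\<le>d. card S choose j)"
proof -
  have "{W. W \<subseteq> S \<and> card W \<le> d} = (\<Union>j\<le>d. {W. W \<subseteq> S \<and> card W = j})"
    by auto
  also have "card \<dots> = (\<Sum>j\<le>d. card {W. W \<subseteq> S \<and> card W = j})"
    using assms by (intro card_UN_disjoint) auto
  finally show ?thesis
    using n_subsets[OF assms] by simp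
qed

text \<open>
  Gaussian elimination: outside a set \<open>P\<close> of at most \<open>card W\<close> pivots, every coordinate of a vector
  in the span of \<open>W\<close> is a linear function of the pivot coordinates.
\<close>

lemma pivots_exist:
  fixes W :: "('i \<Rightarrow> real) set"
  assumes "finite A" "finite W"
  shows "\<exists>P\<subseteq>A. card P \<le> card W \<and>
    (\<forall>c\<in>A - P. \<exists>\<alpha>. \<alpha> c = 1 \<and> (\<forall>i\<in>A - P - {c}. \<alpha> i = 0) \<and> (\<forall>x\<in>W. (\<Sum>i\<in>A. \<alpha> i * x i) = 0))"
  using assms(2)
proof (induction W)
  case empty
  have "\<exists>\<alpha>. \<alpha> c = 1 \<and> (\<forall>i\<in>A - {} - {c}. \<alpha> i = (0 :: real))" for c :: 'i
    by (rule exI[of _ "\<lambda>i. if i = c then 1 else 0"]) auto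
  then show ?case
    by (intro exI[of _ "{}"]) simp
next
  case (insert y W)
  from insert.IH obtain P where P: "P \<subseteq> A" "card P \<le> card W" and
    ex: "\<forall>c\<in>A - P. \<exists>\<alpha>. \<alpha> c = 1 \<and> (\<forall>i\<in>A - P - {c}. \<alpha> i = 0) \<and> (\<forall>x\<in>W. (\<Sum>i\<in>A. \<alpha> i * x i) = 0)"
    by (elim exE conjE) (rule that)
  from bchoice[OF ex] obtain \<alpha> where "\<forall>c\<in>A - P. \<alpha> c c = 1 \<and> (\<forall>i\<in>A - P - {c}. \<alpha> c i = 0) \<and>
      (\<forall>x\<in>W. (\<Sum>i\<in>A. \<alpha> c i * x i) = 0)"
    by (elim exE) (rule that)
  then have \<alpha>: "\<And>c. c \<in> A - P \<Longrightarrow> \<alpha> c c = 1"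
    "\<And>c i. c \<in> A - P \<Longrightarrow> i \<in> A - P - {c} \<Longrightarrow> \<alpha> c i = 0"
    "\<And>c x. c \<in> A - P \<Longrightarrow> x \<in> W \<Longrightarrow> (\<Sum>i\<in>A. \<alpha> c i * x i) = 0"
    by blast+
  show ?case
  proof (cases "\<forall>c\<in>A - P. (\<Sum>i\<in>A. \<alpha> c i * y i) = 0")
    case True
    show ?thesis
      using P insert.hyps \<alpha> True by (intro exI[of _ P]) (auto intro!: exI[of _ "\<alpha> c" for c])
  next
    case False
    then obtain d where d: "d \<in> A - P" "(\<Sum>i\<in>A. \<alpha> d i * y i) \<noteq> 0"
      by auto
    \<comment> \<open>One elimination step: subtracting a multiple of relation \<open>d\<close>
      makes every other relation vanish on \<open>y\<close>, at the price of turning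
      \<open>d\<close> into a pivot.\<close>
    define \<beta> where "\<beta> c i = \<alpha> c i - (\<Sum>i\<in>A. \<alpha> c i * y i) / (\<Sum>i\<in>A. \<alpha> d i * y i) * \<alpha> d i" for c i
    have sum: "(\<Sum>i\<in>A. \<beta> c i * x i) = (\<Sum>i\<in>A. \<alpha> c i * x i)
        - (\<Sum>i\<in>A. \<alpha> c i * y i) / (\<Sum>i\<in>A. \<alpha> d i * y i) * (\<Sum>i\<in>A. \<alpha> d i * x i)" for c x
      unfolding \<beta>_def left_diff_distrib sum_subtractf sum_distrib_left by (simp add: mult.assoc)
    have "(\<Sum>i\<in>A. \<beta> c i * x i) = 0" if "c \<in> A - insert d P" "x \<in> insert y W" for c x
      using that d \<alpha>(3) unfolding sum by auto
    moreover have "\<beta> c c = 1" if "c \<in> A - insert d P" for c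
      using that \<alpha>(1)[of c] \<alpha>(2)[of d c] d by (auto simp: \<beta>_def)
    moreover have "\<beta> c i = 0" if "c \<in> A - insert d P" "i \<in> A - insert d P - {c}" for c i
      using that \<alpha>(2)[of c i] \<alpha>(2)[of d i] d by (auto simp: \<beta>_def)
    ultimately have "\<forall>c\<in>A - insert d P. \<exists>\<alpha>. \<alpha> c = 1 \<and> (\<forall>i\<in>A - insert d P - {c}. \<alpha> i = 0) \<and>
        (\<forall>x\<in>insert y W. (\<Sum>i\<in>A. \<alpha> i * x i) = 0)"
      by (intro ballI exI[of _ "\<beta> c" for c] conjI)
    moreover have "card (insert d P) \<le> card (insert y W)"
      using card_insert_le_m1[of "Suc (card W)" P d] P insert.hyps by simp
    ultimately show ?thesis
      using P d by (intro exI[of _ "insert d P"]) simp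
  qed
qed

section \<open>Affine forms on the cube, interpolation and affine hulls\<close>

definition homog :: "(nat \<Rightarrow> real) \<Rightarrow> nat \<Rightarrow> real" where
  "homog x = x(0 := 1)"

lemma homog_simps [simp]: "homog x 0 = 1" "i \<noteq> 0 \<Longrightarrow> homog x i = x i"
  by (simp_all add: homog_def)

definition aff_form :: "nat \<Rightarrow> (nat \<Rightarrow> real) \<Rightarrow> (nat \<Rightarrow> real) \<Rightarrow> real" where
  "aff_form n w x = w 0 + (\<Sum>i=1..n. w i * x i)"

text \<open>Setting coordinate 0 to 1 makes affine forms linear in n + 1 coordinates, the setting in
  which \<open>pivots_exist\<close> eliminates.\<close>

lemma aff_form_conv_sum: "aff_form n w x = (\<Sum>i\<le>n. w i * homog x i)"
proof -
  have "{..n} = insert 0 {1..n}"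
    by auto
  then show ?thesis
    by (simp add: aff_form_def)
qed

lemma aff_form_lincomb: "aff_form n (\<lambda>i. u i + c * v i) x = aff_form n u x + c * aff_form n v x"
  by (simp add: aff_form_def algebra_simps sum.distrib sum_distrib_left)

lemma finite_cube [simp]: "finite (cube n)"
  by (auto simp: cube_def intro: finite_PiE)

lemma card_cube: "card (cube n) = 2 ^ n"
  by (simp add: cube_def card_PiE numeral_2_eq_2)

text \<open>This is affine independence of \<open>W\<close>, phrased by prescribed values because
  these turn any labelling of \<open>W\<close> into a halfspace.\<close>

definition interpolable :: "nat \<Rightarrow> (nat \<Rightarrow> real) set \<Rightarrow> bool" where
  "interpolable n W \<longleftrightarrow> (\<forall>y. \<exists>w. \<forall>x\<in>W. aff_form n w x = y x)"

text \<open>The cube points in the affine hull of \<open>W\<close>, described dually by the affine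
  forms that vanish on \<open>W\<close>.\<close>

definition flat_hull :: "nat \<Rightarrow> (nat \<Rightarrow> real) set \<Rightarrow> (nat \<Rightarrow> real) set" where
  "flat_hull n W = {x \<in> cube n. \<forall>w. (\<forall>y\<in>W. aff_form n w y = 0) \<longrightarrow> aff_form n w x = 0}"

text \<open>A form that vanishes on \<open>W\<close> but not at \<open>x\<close> corrects the value
  at \<open>x\<close> without disturbing the values on \<open>W\<close>.\<close>

lemma interpolable_insert:
  assumes "interpolable n W" "x \<in> cube n" "x \<notin> flat_hull n W"
  shows "interpolable n (insert x W)"
  unfolding interpolable_def
proof
  fix y
  obtain v where v: "\<forall>z\<in>W. aff_form n v z = 0" "aff_form n v x \<noteq> 0"
    using assms by (auto simp: flat_hull_def)
  obtain u where u: "\<forall>z\<in>W. aff_form n u z = y z"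
    using assms by (auto simp: interpolable_def)
  have "\<forall>z\<in>insert x W. aff_form n (\<lambda>i. u i + (y x - aff_form n u x) / aff_form n v x * v i) z = y z"
  proof
    fix z assume "z \<in> insert x W"
    then show "aff_form n (\<lambda>i. u i + (y x - aff_form n u x) / aff_form n v x * v i) z = y z"
      unfolding aff_form_lincomb using u v by auto
  qed
  then show "\<exists>w. \<forall>z\<in>insert x W. aff_form n w z = y z"
    by blast
qed

text \<open>A point of the hull is determined by its pivot coordinates, each of which is a sign.\<close>

lemma card_flat_hull_le:
  assumes "finite W"
  shows "card (flat_hull n W) \<le> 2 ^ card W"
proof -
  from pivots_exist[OF finite_atMost[of n] finite_imageI[OF assms, of homog]]
  obtain P where P: "P \<subseteq> {..n}" "card P \<le> card (homog ` W)"
    and ex: "\<forall>c\<in>{..n} - P. \<exists>\<alpha>. \<alpha> c = 1 \<and> (\<forall>i\<in>{..n} - P - {c}. \<alpha> i = 0) \<and>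
      (\<forall>x\<in>homog ` W. (\<Sum>i\<le>n. \<alpha> i * x i) = 0)"
    by (elim exE conjE) (rule that)
  \<comment> \<open>Coordinate 0 may be a pivot, but \<open>homog\<close> is 1 there for every
    point, so only the other pivots have to be recorded.\<close>
  define g where "g x = {i \<in> P. i \<noteq> 0 \<and> x i = (1 :: real)}" for x
  have fin: "finite P"
    using P finite_subset by blast
  have "inj_on g (flat_hull n W)"
  proof (rule inj_onI)
    fix x x' assume x: "x \<in> flat_hull n W" and x': "x' \<in> flat_hull n W" and eq: "g x = g x'"
    have vals: "z i = 1 \<or> z i = -1" if "z \<in> flat_hull n W" "i \<in> {1..n}" for z i
      using that by (auto simp: flat_hull_def cube_def PiE_iff)
    have onP: "homog x i = homog x' i" if "i \<in> P" for i
    proof (cases "i = 0")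
      case False
      then have "i \<in> {1..n}"
        using that P by auto
      then show ?thesis
        using vals[OF x, of i] vals[OF x', of i] that False eq[unfolded g_def, THEN eqset_imp_iff, of i]
        by auto
    qed auto
    have "x i = x' i" if "i \<in> {1..n}" for i
    proof (cases "i \<in> P")
      case True
      then show ?thesis
        using onP[of i] that by auto
    next
      case False
      then have "i \<in> {..n} - P"
        using that by simp
      from bspec[OF ex this] obtain \<alpha> where a: "\<alpha> i = 1" "\<forall>j\<in>{..n} - P - {i}. \<alpha> j = 0"
        "\<forall>x\<in>homog ` W. (\<Sum>i\<le>n. \<alpha> i * x i) = 0"
        by (elim exE conjE) (rule that)
      \<comment> \<open>The relation for coordinate \<open>i\<close> is an affine form vanishing on
        \<open>W\<close>, hence on the whole hull, and it expresses that coordinate through the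
        pivots.\<close>
      then have aW: "\<forall>x\<in>W. aff_form n \<alpha> x = 0"
        by (simp add: aff_form_conv_sum)
      have "(\<Sum>j\<le>n. \<alpha> j * homog z j) = z i + (\<Sum>j\<in>P. \<alpha> j * homog z j)" for z :: "nat \<Rightarrow> real"
      proof -
        have "(\<Sum>j\<le>n. \<alpha> j * homog z j) = (\<Sum>j\<in>insert i P. \<alpha> j * homog z j)"
          using a P that by (intro sum.mono_neutral_right) auto
        then show ?thesis
          using False fin a that by simp
      qed
      moreover have "(\<Sum>j\<le>n. \<alpha> j * homog x j) = 0" "(\<Sum>j\<le>n. \<alpha> j * homog x' j) = 0"
        using x x' aW by (simp_all add: flat_hull_def aff_form_conv_sum[symmetric])
      moreover have "(\<Sum>j\<in>P. \<alpha> j * homog x j) = (\<Sum>j\<in>P. \<alpha> j * homog x' j)"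
        using onP by (intro sum.cong) auto
      ultimately show ?thesis
        by simp
    qed
    then show "x = x'"
      using x x' by (auto simp: flat_hull_def cube_def intro: PiE_ext)
  qed
  then have "card (flat_hull n W) \<le> card (Pow P)"
    using fin by (intro card_inj_on_le[of g]) (auto simp: g_def)
  also have "\<dots> = 2 ^ card P"
    using fin by (simp add: card_Pow)
  also have "\<dots> \<le> 2 ^ card W"
    using P(2) card_image_le[OF assms, of homog] by (intro power_increasing) auto
  finally show ?thesis .
qed

text \<open>Greedy choice: the hulls of all small subsets of the current set together cover fewer
  than 2^n points, and any uncovered point of the cube can be added.\<close>

lemma general_position_exists:
  assumes "1 \<le> k" and bound: "(\<Sum>j\<le>k. N choose j) * 2 ^ k < 2 ^ n"
  shows "\<exists>S\<subseteq>cube n. card S = N \<and> (\<forall>W\<subseteq>S. card W \<le> k \<longrightarrow> interpolable n W)"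
proof -
  have "\<exists>S\<subseteq>cube n. card S = m \<and> (\<forall>W\<subseteq>S. card W \<le> k \<longrightarrow> interpolable n W)" if "m \<le> N" for m
    using that
  proof (induction m)
    case 0
    show ?case
      by (intro exI[of _ "{}"]) (auto simp: interpolable_def)
  next
    case (Suc m)
    then obtain S where S: "S \<subseteq> cube n" "card S = m" "\<forall>W\<subseteq>S. card W \<le> k \<longrightarrow> interpolable n W"
      by auto
    have fin: "finite S"
      using finite_subset[OF S(1)] by simp
    let ?\<W> = "{W. W \<subseteq> S \<and> card W \<le> k}"
    have "card (\<Union>W\<in>?\<W>. flat_hull n W) \<le> (\<Sum>W\<in>?\<W>. card (flat_hull n W))"
      using fin by (intro card_UN_le) auto
    also have "\<dots> \<le> (\<Sum>W\<in>?\<W>. 2 ^ k)"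
    proof (intro sum_mono)
      fix W assume "W \<in> ?\<W>"
      then have "card (flat_hull n W) \<le> 2 ^ card W" "(2 :: nat) ^ card W \<le> 2 ^ k"
        using fin finite_subset[of W S] by (auto intro: card_flat_hull_le power_increasing)
      then show "card (flat_hull n W) \<le> 2 ^ k"
        by (rule order_trans)
    qed
    also have "\<dots> = (\<Sum>j\<le>k. m choose j) * 2 ^ k"
      using card_subsets_le[OF fin, of k] S by simp
    also have "\<dots> \<le> (\<Sum>j\<le>k. N choose j) * 2 ^ k"
      using Suc.prems by (intro mult_right_mono sum_mono binomial_right_mono) simp_all
    also have "\<dots> < card (cube n)"
      using bound by (simp add: card_cube)
    finally have less: "card (\<Union>W\<in>?\<W>. flat_hull n W) < card (cube n)" .
    have "finite (\<Union>W\<in>?\<W>. flat_hull n W)"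
      by (rule finite_subset[of _ "cube n"]) (auto simp: flat_hull_def)
    with less have "\<not> cube n \<subseteq> (\<Union>W\<in>?\<W>. flat_hull n W)"
      using card_mono linorder_not_le by blast
    then obtain x where x: "x \<in> cube n" "\<And>W. W \<subseteq> S \<Longrightarrow> card W \<le> k \<Longrightarrow> x \<notin> flat_hull n W"
      by auto
    \<comment> \<open>A point lies in the hull of its own singleton, which is among the avoided
      hulls since k is at least 1.\<close>
    have "x \<notin> S"
      using x(1) x(2)[of "{x}"] \<open>1 \<le> k\<close> by (auto simp: flat_hull_def)
    moreover have "interpolable n W" if W: "W \<subseteq> insert x S" "card W \<le> k" for W
    proof (cases "x \<in> W")
      case True
      have "card (W - {x}) \<le> k"
        using W(2) card_Diff1_le[of W x] by simp
      moreover have "W - {x} \<subseteq> S"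
        using W(1) by blast
      ultimately have "interpolable n (insert x (W - {x}))"
        using S(3) x by (intro interpolable_insert) simp_all
      then show ?thesis
        using True by (simp add: insert_absorb)
    next
      case False
      then show ?thesis
        using W S(3) by (simp add: subset_insert)
    qed
    ultimately show ?case
      using S(1,2) x(1) fin by (intro exI[of _ "insert x S"]) simp
  qed
  then show ?thesis
    by simp
qed

section \<open>Functions far from halfspaces\<close>

text \<open>Pajor's form of the Sauer--Shelah lemma.\<close>

lemma card_le_card_shattered:
  assumes "finite S" "F \<subseteq> Pow S"
  shows "card F \<le> card {A \<in> Pow S. \<forall>B\<subseteq>A. \<exists>C\<in>F. C \<inter> A = B}"
  using assms
proof (induction S arbitrary: F)
  case empty
  then have "F = {} \<or> F = {{}}"
    by (simp add: subset_singleton_iff)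
  then show ?case
  proof
    assume "F = {{}}"
    then have "{A \<in> Pow {}. \<forall>B\<subseteq>A. \<exists>C\<in>F. C \<inter> A = B} = {{}}"
      by auto
    with \<open>F = {{}}\<close> show ?case
      by simp
  qed simp
next
  case (insert s S)
  define sh where "sh S F = {A \<in> Pow S. \<forall>B\<subseteq>A. \<exists>C\<in>F. C \<inter> A = B}" for S :: "'a set" and F
  define F0 where "F0 = {C \<in> F. s \<notin> C}"
  define F1 where "F1 = (\<lambda>C. C - {s}) ` {C \<in> F. s \<in> C}"
  have notin: "s \<notin> A" if "A \<in> sh S G" for A G
    using that insert.hyps by (auto simp: sh_def)
  have sub: "F0 \<subseteq> Pow S" "F1 \<subseteq> Pow S"
    using insert.prems by (auto simp: F0_def F1_def)
  then have fin: "finite F0" "finite F1"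
    using insert.hyps by (auto intro: finite_subset)
  have finF: "finite F"
    using insert.prems insert.hyps by (auto intro: finite_subset)
  have "card F = card F0 + card {C \<in> F. s \<in> C}"
    using finF by (subst card_Un_disjoint[symmetric]) (auto simp: F0_def intro: arg_cong[of _ _ card])
  also have "card {C \<in> F. s \<in> C} = card F1"
    unfolding F1_def by (intro card_image[symmetric]) (auto simp: inj_on_def)
  \<comment> \<open>A set shattered by the union is shattered by \<open>F\<close>. Members of the
    intersection occur in \<open>F\<close> both with and without \<open>s\<close>, so a set
    shattered by it stays shattered after adding \<open>s\<close>.\<close>
  also have "card F0 + card F1 = card (F0 \<union> F1) + card (F0 \<inter> F1)"
    using fin by (rule card_Un_Int)
  also have "\<dots> \<le> card (sh S (F0 \<union> F1)) + card (sh S (F0 \<inter> F1))"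
    unfolding sh_def using sub by (intro add_mono insert.IH) blast+
  also have "card (sh S (F0 \<inter> F1)) = card (insert s ` sh S (F0 \<inter> F1))"
    by (intro card_image[symmetric] inj_onI) (metis insert_ident notin)
  also have "card (sh S (F0 \<union> F1)) + card (insert s ` sh S (F0 \<inter> F1))
      = card (sh S (F0 \<union> F1) \<union> insert s ` sh S (F0 \<inter> F1))"
    using insert.hyps notin by (intro card_Un_disjoint[symmetric]) (auto simp: sh_def)
  also have "\<dots> \<le> card (sh (insert s S) F)"
  proof (intro card_mono Un_least subsetI)
    fix A assume "A \<in> sh S (F0 \<union> F1)"
    then have A: "A \<subseteq> S" "s \<notin> A" "\<And>B. B \<subseteq> A \<Longrightarrow> \<exists>C\<in>F0 \<union> F1. C \<inter> A = B"
      unfolding sh_def using insert.hyps by blast+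
    have "\<exists>C\<in>F. C \<inter> A = B" if B: "B \<subseteq> A" for B
    proof -
      from A(3)[OF B] obtain C where C: "C \<in> F0 \<union> F1" "C \<inter> A = B"
        by blast
      from C(1) show ?thesis
      proof
        assume "C \<in> F0"
        then show ?thesis
          using C(2) unfolding F0_def by blast
      next
        assume "C \<in> F1"
        then obtain C' where "C' \<in> F" "C = C' - {s}"
          unfolding F1_def by blast
        moreover have "C' \<inter> A = (C' - {s}) \<inter> A"
          using A(2) by blast
        ultimately show ?thesis
          using C(2) by (intro bexI[of _ C']) simp_all
      qed
    qed
    then show "A \<in> sh (insert s S) F"
      unfolding sh_def using A(1) by blast
  next
    fix A' assume "A' \<in> insert s ` sh S (F0 \<inter> F1)"
    then obtain A where "A \<in> sh S (F0 \<inter> F1)" and A': "A' = insert s A"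
      by blast
    then have A: "A \<subseteq> S" "s \<notin> A" "\<And>B. B \<subseteq> A \<Longrightarrow> \<exists>C\<in>F0 \<inter> F1. C \<inter> A = B"
      unfolding sh_def using insert.hyps by blast+
    have "\<exists>C\<in>F. C \<inter> A' = B" if B: "B \<subseteq> A'" for B
    proof -
      have "B - {s} \<subseteq> A"
        using B A' by blast
      from A(3)[OF this] obtain C where C: "C \<in> F0" "C \<in> F1" "C \<inter> A = B - {s}"
        by blast
      show ?thesis
      proof (cases "s \<in> B")
        case True
        from C(2) obtain C' where C': "C' \<in> F" "s \<in> C'" "C = C' - {s}"
          unfolding F1_def by blast
        then have "C' \<inter> A' = B"
          using C(3) True A' A(2) by blast
        with C'(1) show ?thesis
          by blast
      next
        case False
        have "C \<in> F" "s \<notin> C"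
          using C(1) by (simp_all add: F0_def)
        then have "C \<inter> A' = B"
          using C(3) False A' by blast
        with \<open>C \<in> F\<close> show ?thesis
          by blast
      qed
    qed
    then show "A' \<in> sh (insert s S) F"
      unfolding sh_def using A(1) A' by blast
  qed (use insert.hyps in \<open>auto simp: sh_def\<close>)
  finally show ?case
    by (simp add: sh_def)
qed

lemma halfspaces_eq: "halfspaces n = {f. \<exists>w. f = (\<lambda>x\<in>cube n. sign_pm (aff_form n w x))}"
  by (simp add: halfspaces_def aff_form_def)

text \<open>Radon's argument: n + 2 points have a nontrivial affine dependence, and no affine form
  can have the signs opposite to its coefficients, since the weighted sum of the values is
  zero.\<close>

lemma card_shattered_le:
  assumes "A \<subseteq> cube n" and shat: "\<forall>B\<subseteq>A. \<exists>h\<in>halfspaces n. {x \<in> A. h x = 1} = B"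
  shows "card A \<le> n + 1"
proof (rule ccontr)
  assume less: "\<not> card A \<le> n + 1"
  have fin: "finite A"
    using finite_subset[OF assms(1)] by simp
  \<comment> \<open>The matrix is transposed here: the n + 1 coordinate functions are the vectors,
    indexed by the points of \<open>A\<close>, so a relation among indices is an affine dependence
    of points.\<close>
  define g where "g i x = homog x i" for i :: nat and x :: "nat \<Rightarrow> real"
  have "finite (g ` {..n})"
    by simp
  from pivots_exist[OF fin this] obtain P where P: "P \<subseteq> A" "card P \<le> card (g ` {..n})"
    and \<alpha>: "\<forall>c\<in>A - P. \<exists>\<alpha>. \<alpha> c = 1 \<and> (\<forall>i\<in>A - P - {c}. \<alpha> i = 0) \<and>
      (\<forall>y\<in>g ` {..n}. (\<Sum>x\<in>A. \<alpha> x * y x) = 0)"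
    by (elim exE conjE) (rule that)
  have "card (g ` {..n}) \<le> n + 1"
    using card_image_le[of "{..n}" g] by simp
  then have "P \<noteq> A"
    using P less by auto
  then obtain c where c: "c \<in> A - P"
    using P by auto
  from bspec[OF \<alpha> c] obtain \<alpha> where a: "\<alpha> c = 1"
    and ag: "\<forall>y\<in>g ` {..n}. (\<Sum>x\<in>A. \<alpha> x * y x) = 0"
    by (elim exE conjE) (rule that)
  have a0: "(\<Sum>x\<in>A. \<alpha> x * homog x i) = 0" if "i \<le> n" for i
    using bspec[OF ag, of "g i"] that by (simp add: g_def)
  \<comment> \<open>Points with negative coefficient get label 1, so that the positive coefficient
    at \<open>c\<close> meets a strictly negative value; a value of zero has label 1 and would give
    no strict inequality there.\<close>
  have "{x \<in> A. \<alpha> x < 0} \<subseteq> A"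
    by blast
  with shat obtain h where h: "h \<in> halfspaces n" "{x \<in> A. h x = 1} = {x \<in> A. \<alpha> x < 0}"
    by blast
  from h(1) obtain w where w: "h = (\<lambda>x\<in>cube n. sign_pm (aff_form n w x))"
    unfolding halfspaces_eq by blast
  have sgn: "aff_form n w x \<ge> 0 \<longleftrightarrow> \<alpha> x < 0" if "x \<in> A" for x
  proof -
    have "h x = 1 \<longleftrightarrow> \<alpha> x < 0"
      using eqset_imp_iff[OF h(2), of x] that by simp
    moreover have "x \<in> cube n"
      using that assms(1) by blast
    ultimately show ?thesis
      by (simp add: w sign_pm_def split: if_splits)
  qed
  have "(\<Sum>x\<in>A. \<alpha> x * aff_form n w x) = (\<Sum>x\<in>A. \<Sum>i\<le>n. w i * (\<alpha> x * homog x i))"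
    by (simp add: aff_form_conv_sum sum_distrib_left algebra_simps)
  also have "\<dots> = (\<Sum>i\<le>n. w i * (\<Sum>x\<in>A. \<alpha> x * homog x i))"
    by (subst sum.swap) (simp add: sum_distrib_left)
  also have "\<dots> = 0"
    using a0 by simp
  also have "0 < (\<Sum>x\<in>A. - (\<alpha> x * aff_form n w x))"
  proof (rule sum_pos2[OF fin DiffD1[OF c]])
    show "0 < - (\<alpha> c * aff_form n w c)"
      using sgn[OF DiffD1[OF c]] a by auto
    show "0 \<le> - (\<alpha> x * aff_form n w x)" if "x \<in> A" for x
      using sgn[OF that] by (cases "\<alpha> x < 0") (auto simp: mult_le_0_iff)
  qed
  ultimately show False
    by (simp add: sum_negf)
qed

lemma card_traces_le:
  assumes "S \<subseteq> cube n"
  shows "card ((\<lambda>h. {x \<in> S. h x = 1}) ` halfspaces n) \<le> (\<Sum>j\<le>n+1. card S choose j)"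
proof -
  have fin: "finite S"
    using finite_subset[OF assms(1)] by simp
  define F where "F = (\<lambda>h. {x \<in> S. h x = 1}) ` halfspaces n"
  have "card F \<le> card {A \<in> Pow S. \<forall>B\<subseteq>A. \<exists>C\<in>F. C \<inter> A = B}"
    using fin by (intro card_le_card_shattered) (auto simp: F_def)
  also have "\<dots> \<le> card {A. A \<subseteq> S \<and> card A \<le> n + 1}"
  proof (intro card_mono subsetI)
    fix A assume "A \<in> {A \<in> Pow S. \<forall>B\<subseteq>A. \<exists>C\<in>F. C \<inter> A = B}"
    then have A: "A \<subseteq> S" "\<And>B. B \<subseteq> A \<Longrightarrow> \<exists>C\<in>F. C \<inter> A = B"
      by blast+
    have "\<exists>h\<in>halfspaces n. {x \<in> A. h x = 1} = B" if "B \<subseteq> A" for B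
    proof -
      from A(2)[OF that] obtain h where "h \<in> halfspaces n" "{x \<in> S. h x = 1} \<inter> A = B"
        unfolding F_def by blast
      moreover have "{x \<in> A. h x = 1} = {x \<in> S. h x = 1} \<inter> A"
        using A(1) by blast
      ultimately show ?thesis
        by (intro bexI[of _ h]) simp_all
    qed
    then have "card A \<le> n + 1"
      using A(1) assms by (intro card_shattered_le) blast+
    then show "A \<in> {A. A \<subseteq> S \<and> card A \<le> n + 1}"
      using A(1) by simp
  qed (use fin in auto)
  finally show ?thesis
    using card_subsets_le[OF fin] by (simp add: F_def)
qed

lemma halfspaces_values:
  assumes "h \<in> halfspaces n" "x \<in> cube n"
  shows "h x = 1 \<or> h x = -1"
proof -
  from assms(1) obtain w where "h = (\<lambda>x\<in>cube n. sign_pm (aff_form n w x))"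
    unfolding halfspaces_eq by blast
  then show ?thesis
    using assms(2) by (simp add: sign_pm_def)
qed

text \<open>Counting: the Hamming balls of radius \<rho> around all traces of halfspaces on
  \<open>S\<close> do not exhaust the subsets of \<open>S\<close>.\<close>

lemma far_function_exists:
  assumes "S \<subseteq> cube n"
    and bound: "(\<Sum>j\<le>n+1. card S choose j) * (\<Sum>j\<le>\<rho>. card S choose j) < 2 ^ card S"
  shows "\<exists>f\<in>cube n \<rightarrow>\<^sub>E {-1, 1}. \<forall>h\<in>halfspaces n. \<rho> < card {x \<in> S. f x \<noteq> h x}"
proof -
  have fin: "finite S"
    using finite_subset[OF assms(1)] by simp
  define F where "F = (\<lambda>h. {x \<in> S. h x = 1}) ` halfspaces n"
  define ball where "ball C = {B. B \<subseteq> S \<and> card (sym_diff B C) \<le> \<rho>}" for C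
  have F_sub: "F \<subseteq> Pow S"
    by (auto simp: F_def)
  then have finF: "finite F"
    using fin finite_subset by blast
  have "card (ball C) \<le> (\<Sum>j\<le>\<rho>. card S choose j)" if "C \<in> F" for C
  proof -
    have "C \<subseteq> S"
      using that F_sub by blast
    have "card (ball C) \<le> card {W. W \<subseteq> S \<and> card W \<le> \<rho>}"
    proof (rule card_inj_on_le[of "\<lambda>B. sym_diff B C"])
      show "inj_on (\<lambda>B. sym_diff B C) (ball C)"
        by (rule inj_onI) blast
      show "(\<lambda>B. sym_diff B C) ` ball C \<subseteq> {W. W \<subseteq> S \<and> card W \<le> \<rho>}"
        unfolding ball_def using \<open>C \<subseteq> S\<close> by blast
    qed (use fin in simp)
    then show ?thesis
      using card_subsets_le[OF fin] by simp
  qed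
  then have "(\<Sum>C\<in>F. card (ball C)) \<le> card F * (\<Sum>j\<le>\<rho>. card S choose j)"
    using sum_bounded_above[of F "\<lambda>C. card (ball C)"] by simp
  moreover have "card (\<Union>C\<in>F. ball C) \<le> (\<Sum>C\<in>F. card (ball C))"
    using finF by (rule card_UN_le)
  moreover have "card F * (\<Sum>j\<le>\<rho>. card S choose j) \<le> (\<Sum>j\<le>n+1. card S choose j) * (\<Sum>j\<le>\<rho>. card S choose j)"
    unfolding F_def using card_traces_le[OF assms(1)] by (intro mult_right_mono) simp_all
  ultimately have less: "card (\<Union>C\<in>F. ball C) < card (Pow S)"
    using bound card_Pow[OF fin] by linarith
  have "finite (\<Union>C\<in>F. ball C)"
    by (rule finite_subset[of _ "Pow S"]) (use fin in \<open>auto simp: ball_def\<close>)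
  with less have "\<not> Pow S \<subseteq> (\<Union>C\<in>F. ball C)"
    using card_mono linorder_not_le by blast
  then obtain B where "B \<in> Pow S" "B \<notin> (\<Union>C\<in>F. ball C)"
    by blast
  then have B: "B \<subseteq> S" "\<And>C. C \<in> F \<Longrightarrow> \<rho> < card (sym_diff B C)"
    unfolding ball_def by (simp_all add: not_le)
  define f where "f = (\<lambda>x\<in>cube n. if x \<in> B then 1 else -1 :: real)"
  have "\<rho> < card {x \<in> S. f x \<noteq> h x}" if h: "h \<in> halfspaces n" for h
  proof -
    have "f x \<noteq> h x \<longleftrightarrow> x \<in> sym_diff B {x \<in> S. h x = 1}" if "x \<in> S" for x
    proof -
      have "x \<in> cube n"
        using that assms(1) by blast
      then show ?thesis
        using halfspaces_values[OF h, of x] that by (auto simp: f_def)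
    qed
    then have "{x \<in> S. f x \<noteq> h x} = sym_diff B {x \<in> S. h x = 1}"
      using B(1) by blast
    then show ?thesis
      using B(2)[of "{x \<in> S. h x = 1}"] h by (simp add: F_def)
  qed
  moreover have "f \<in> cube n \<rightarrow>\<^sub>E {-1, 1}"
    by (simp add: f_def)
  ultimately show ?thesis
    by blast
qed

section \<open>Random variables with matching moments\<close>

lemma alternating_binomial_shift:
  fixes g :: "nat \<Rightarrow> real"
  shows "(\<Sum>j\<le>Suc N. (-1) ^ j * real (Suc N choose j) * g j)
    = (\<Sum>j\<le>N. (-1) ^ j * real (N choose j) * (g j - g (Suc j)))"
proof -
  have "(\<Sum>j\<le>Suc N. (-1) ^ j * real (Suc N choose j) * g j)
      = g 0 + (\<Sum>j\<le>N. (-1) ^ Suc j * real (N choose Suc j) * g (Suc j))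
        - (\<Sum>j\<le>N. (-1) ^ j * real (N choose j) * g (Suc j))"
    unfolding sum.atMost_Suc_shift
    by (simp add: algebra_simps sum.distrib[symmetric] sum_subtractf[symmetric] del: sum.atMost_Suc)
  also have "g 0 + (\<Sum>j\<le>N. (-1) ^ Suc j * real (N choose Suc j) * g (Suc j))
      = (\<Sum>j\<le>Suc N. (-1) ^ j * real (N choose j) * g j)"
    unfolding sum.atMost_Suc_shift by simp
  finally show ?thesis
    by (simp add: right_diff_distrib sum_subtractf)
qed

text \<open>The N-fold finite difference of a polynomial of degree below N is zero; each difference
  lowers the degree by one.\<close>

lemma alternating_binomial_power:
  fixes z :: real
  shows "m < N \<Longrightarrow> (\<Sum>j\<le>N. (-1) ^ j * real (N choose j) * (z + real j) ^ m) = 0"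
proof (induction N arbitrary: m z)
  case (Suc N)
  have diff: "t ^ m - (t + 1) ^ m = - (\<Sum>l<m. real (m choose l) * t ^ l)" for t :: real
    using binomial_ring[of t 1 m] by (simp add: lessThan_Suc_atMost[symmetric])
  have "(\<Sum>j\<le>Suc N. (-1) ^ j * real (Suc N choose j) * (z + real j) ^ m)
      = (\<Sum>j\<le>N. (-1) ^ j * real (N choose j) * ((z + real j) ^ m - (z + real j + 1) ^ m))"
    unfolding alternating_binomial_shift by (simp add: algebra_simps)
  also have "\<dots> = - (\<Sum>j\<le>N. \<Sum>l<m. real (m choose l) * ((-1) ^ j * real (N choose j) * (z + real j) ^ l))"
    unfolding diff by (simp add: sum_distrib_left sum_negf mult_ac)
  also have "(\<Sum>j\<le>N. \<Sum>l<m. real (m choose l) * ((-1) ^ j * real (N choose j) * (z + real j) ^ l))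
      = (\<Sum>l<m. real (m choose l) * (\<Sum>j\<le>N. (-1) ^ j * real (N choose j) * (z + real j) ^ l))"
    by (subst sum.swap) (simp add: sum_distrib_left)
  also have "\<dots> = 0"
    using Suc.IH Suc.prems by (intro sum.neutral ballI) simp
  finally show ?case
    by simp
qed simp

text \<open>The quotient (x^k - a^k) / (x - a) is a polynomial of degree below k, so the original
  weights annihilate it. Dividing by x - a and adding a compensating atom at a thus gains one more
  vanishing moment.\<close>

lemma moments_divide:
  fixes c x :: "'i \<Rightarrow> real"
  assumes "\<And>k. k < K \<Longrightarrow> (\<Sum>j\<in>J. c j * x j ^ k) = 0" "\<And>j. j \<in> J \<Longrightarrow> x j \<noteq> a" "k \<le> K"
  shows "(\<Sum>j\<in>J. c j / (x j - a) * x j ^ k) = (\<Sum>j\<in>J. c j / (x j - a)) * a ^ k"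
proof -
  have "(\<Sum>j\<in>J. c j / (x j - a) * x j ^ k) - (\<Sum>j\<in>J. c j / (x j - a)) * a ^ k
      = (\<Sum>j\<in>J. c j / (x j - a) * (x j ^ k - a ^ k))"
    by (simp add: sum_distrib_right right_diff_distrib sum_subtractf)
  also have "\<dots> = (\<Sum>j\<in>J. \<Sum>i<k. a ^ (k - Suc i) * (c j * x j ^ i))"
  proof (intro sum.cong refl)
    fix j assume "j \<in> J"
    then have "x j - a \<noteq> 0"
      using assms(2) by simp
    then show "c j / (x j - a) * (x j ^ k - a ^ k) = (\<Sum>i<k. a ^ (k - Suc i) * (c j * x j ^ i))"
      unfolding power_diff_sumr2 by (simp add: sum_distrib_left mult_ac)
  qed
  also have "\<dots> = (\<Sum>i<k. a ^ (k - Suc i) * (\<Sum>j\<in>J. c j * x j ^ i))"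
    by (subst sum.swap) (simp add: sum_distrib_left)
  also have "\<dots> = 0"
    using assms(1,3) by simp
  finally show ?thesis
    by simp
qed

text \<open>The indices r - i and r + i give the same square.\<close>

lemma sum_centred_squares:
  fixes h :: "real \<Rightarrow> real"
  shows "(\<Sum>j\<in>{..2*r} - {r}. h ((real j - real r)\<^sup>2)) = 2 * (\<Sum>i=1..r. h ((real i)\<^sup>2))"
proof -
  have eq: "{..2*r} - {r} = {..<r} \<union> {r<..2*r}"
    by auto
  have "(\<Sum>j\<in>{..2*r} - {r}. h ((real j - real r)\<^sup>2))
      = (\<Sum>j\<in>{..<r}. h ((real j - real r)\<^sup>2)) + (\<Sum>j\<in>{r<..2*r}. h ((real j - real r)\<^sup>2))"
    unfolding eq by (intro sum.union_disjoint) auto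
  also have "(\<Sum>j\<in>{..<r}. h ((real j - real r)\<^sup>2)) = (\<Sum>i=1..r. h ((real i)\<^sup>2))"
    by (rule sum.reindex_bij_witness[of _ "\<lambda>i. r - i" "\<lambda>j. r - j"])
      (auto simp: of_nat_diff power2_commute)
  also have "(\<Sum>j\<in>{r<..2*r}. h ((real j - real r)\<^sup>2)) = (\<Sum>i=1..r. h ((real i)\<^sup>2))"
    by (rule sum.reindex_bij_witness[of _ "\<lambda>i. r + i" "\<lambda>j. j - r"]) (auto simp: of_nat_diff)
  finally show ?thesis
    by simp
qed

lemma sum_inverse_squares_le: "(\<Sum>i=1..r. 1 / (real i)\<^sup>2) \<le> 2"
proof -
  have "(\<Sum>i=1..r. 1 / (real i)\<^sup>2) \<le> 2 - 1 / real r" if "r \<ge> 1" for r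
    using that
  proof (induction r rule: dec_induct)
    case (step r)
    have "1 / (real (Suc r))\<^sup>2 \<le> 1 / (real r * real (Suc r))"
      using step.hyps by (intro divide_left_mono) (auto simp: power2_eq_square)
    also have "\<dots> = 1 / real r - 1 / real (Suc r)"
      using step.hyps by (simp add: field_simps)
    finally show ?case
      using step by simp
  qed simp
  from this[of r] show ?thesis
    by (cases "r = 0") (simp_all add: order_trans[of _ "2 - 1 / real r" 2])
qed

text \<open>The pmf is built on the indices and pushed forward, so that \<open>x\<close> may take a
  value several times; the squares used below do.\<close>

lemma finite_pmf_exists:
  fixes p x :: "nat \<Rightarrow> real"
  assumes "finite I" "\<And>i. i \<in> I \<Longrightarrow> p i \<ge> 0" "(\<Sum>i\<in>I. p i) = 1"
  shows "\<exists>P :: real pmf. set_pmf P \<subseteq> x ` I \<and>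
    (\<forall>f :: real \<Rightarrow> real. measure_pmf.expectation P f = (\<Sum>i\<in>I. p i * f (x i)))"
proof -
  define q where "q i = (if i \<in> I then p i else 0)" for i
  have "(\<integral>\<^sup>+ i. ennreal (q i) \<partial>count_space UNIV) = (\<Sum>i\<in>I. ennreal (q i))"
    using assms(1) by (intro nn_integral_count_space'[of I]) (auto simp: q_def)
  also have "\<dots> = ennreal (\<Sum>i\<in>I. q i)"
    using assms(2) by (intro sum_ennreal) (auto simp: q_def)
  also have "(\<Sum>i\<in>I. q i) = 1"
    using assms(3) by (simp add: q_def)
  finally have int: "(\<integral>\<^sup>+ i. ennreal (q i) \<partial>count_space UNIV) = 1"
    by simp
  have nonneg: "q i \<ge> 0" for i
    using assms(2) by (simp add: q_def)
  define Q where "Q = embed_pmf q"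
  have Q: "pmf Q i = q i" for i
    unfolding Q_def using int nonneg by (intro pmf_embed_pmf) auto
  have set_Q: "set_pmf Q \<subseteq> I"
    by (auto simp: set_pmf_eq Q q_def split: if_splits)
  have "measure_pmf.expectation (map_pmf x Q) f = (\<Sum>i\<in>I. p i * f (x i))" for f :: "real \<Rightarrow> real"
  proof -
    have "measure_pmf.expectation (map_pmf x Q) f = (\<Sum>i\<in>I. f (x i) * pmf Q i)"
      using set_Q assms(1) by (simp, intro integral_measure_pmf_real) auto
    then show ?thesis
      by (simp add: Q q_def mult.commute)
  qed
  then show ?thesis
    using set_Q by (intro exI[of _ "map_pmf x Q"]) auto
qed


text \<open>Jordan decomposition: the zeroth moment gives the positive and the negative part the
  same total mass. As this mass is at least 1, normalising only decreases expectations of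
  nonnegative functions.\<close>

lemma signed_measure_split:
  fixes W y :: "nat \<Rightarrow> real"
  assumes "finite I" and mom: "\<forall>k\<le>r. (\<Sum>i\<in>I. W i * y i ^ k) = 0"
    and big: "1 \<le> (\<Sum>i\<in>I. max (W i) 0)"
  shows "\<exists>U V :: real pmf. set_pmf U \<subseteq> y ` I \<and> set_pmf V \<subseteq> y ` I \<and>
    (\<forall>k\<le>r. measure_pmf.expectation U (\<lambda>x. x ^ k) = measure_pmf.expectation V (\<lambda>x. x ^ k)) \<and>
    (\<forall>f :: real \<Rightarrow> real. (\<forall>i\<in>I. 0 \<le> f (y i)) \<longrightarrow>
      measure_pmf.expectation U f \<le> (\<Sum>i\<in>I. max (W i) 0 * f (y i)) \<and>
      measure_pmf.expectation V f \<le> (\<Sum>i\<in>I. max (- W i) 0 * f (y i)))"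
proof -
  define Z where "Z = (\<Sum>i\<in>I. max (W i) 0)"
  have "max (W i) 0 - max (- W i) 0 = W i" for i
    by (simp add: max_def)
  then have split: "(\<Sum>i\<in>I. max (W i) 0 * g i) - (\<Sum>i\<in>I. max (- W i) 0 * g i) = (\<Sum>i\<in>I. W i * g i)" for g
    by (simp add: sum_subtractf[symmetric] left_diff_distrib[symmetric])
  have Z: "Z \<ge> 1" "Z = (\<Sum>i\<in>I. max (- W i) 0)"
    using big split[of "\<lambda>_. 1"] mom[rule_format, of 0] by (simp_all add: Z_def)
  have "(\<Sum>i\<in>I. max (W i) 0 / Z) = 1"
    unfolding sum_divide_distrib[symmetric] using Z by (simp add: Z_def[symmetric])
  with Z finite_pmf_exists[OF assms(1), of "\<lambda>i. max (W i) 0 / Z" y] have "\<exists>P :: real pmf. set_pmf P \<subseteq> y ` I \<and>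
      (\<forall>f :: real \<Rightarrow> real. measure_pmf.expectation P f = (\<Sum>i\<in>I. max (W i) 0 / Z * f (y i)))"
    by simp
  then obtain U :: "real pmf" where U: "set_pmf U \<subseteq> y ` I"
      "\<forall>f :: real \<Rightarrow> real. measure_pmf.expectation U f = (\<Sum>i\<in>I. max (W i) 0 / Z * f (y i))"
    by (elim exE conjE) (rule that)
  have "(\<Sum>i\<in>I. max (- W i) 0 / Z) = 1"
    unfolding sum_divide_distrib[symmetric] using Z by simp
  with Z finite_pmf_exists[OF assms(1), of "\<lambda>i. max (- W i) 0 / Z" y] have "\<exists>P :: real pmf. set_pmf P \<subseteq> y ` I \<and>
      (\<forall>f :: real \<Rightarrow> real. measure_pmf.expectation P f = (\<Sum>i\<in>I. max (- W i) 0 / Z * f (y i)))"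
    by simp
  then obtain V :: "real pmf" where V: "set_pmf V \<subseteq> y ` I"
      "\<forall>f :: real \<Rightarrow> real. measure_pmf.expectation V f = (\<Sum>i\<in>I. max (- W i) 0 / Z * f (y i))"
    by (elim exE conjE) (rule that)
  have mom_eq: "measure_pmf.expectation U (\<lambda>x. x ^ k) = measure_pmf.expectation V (\<lambda>x. x ^ k)" if "k \<le> r" for k
  proof -
    have "(\<Sum>i\<in>I. max (W i) 0 * y i ^ k) = (\<Sum>i\<in>I. max (- W i) 0 * y i ^ k)"
      using split[of "\<lambda>i. y i ^ k"] mom that by simp
    then show ?thesis
      unfolding U(2)[rule_format] V(2)[rule_format] times_divide_eq_left sum_divide_distrib[symmetric]
      by simp
  qed
  have le: "(\<Sum>i\<in>I. w i / Z * f (y i)) \<le> (\<Sum>i\<in>I. w i * f (y i))"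
    if "\<forall>i\<in>I. 0 \<le> f (y i)" "\<forall>i\<in>I. 0 \<le> w i" for f :: "real \<Rightarrow> real" and w
  proof (intro sum_mono mult_right_mono)
    fix i assume "i \<in> I"
    then have "0 \<le> w i" "0 \<le> f (y i)"
      using that by auto
    then show "w i / Z \<le> w i" "0 \<le> f (y i)"
      using Z(1) mult_left_mono[of 1 Z "w i"] by (simp_all add: divide_le_eq)
  qed
  have "measure_pmf.expectation U f \<le> (\<Sum>i\<in>I. max (W i) 0 * f (y i))"
    "measure_pmf.expectation V f \<le> (\<Sum>i\<in>I. max (- W i) 0 * f (y i))"
    if "\<forall>i\<in>I. 0 \<le> f (y i)" for f :: "real \<Rightarrow> real"
    unfolding U(2)[rule_format] V(2)[rule_format] using that by (intro le; simp)+
  with mom_eq show ?thesis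
    using U(1) V(1) by blast
qed

text \<open>
  The signed measure with weights \<open>(-1)\<^sup>j (2r choose j)\<close> at the squares \<open>(j - r)\<^sup>2\<close> annihilates all
  polynomials of degree less than \<open>r\<close>. Dividing it by \<open>(x - a) (x - b)\<close>, at the price of atoms at
  \<open>a\<close> and \<open>b\<close>, makes the tail summable against \<open>x\<close>, so that almost all of the positive part sits at
  \<open>0\<close> and almost all of the negative part at \<open>a\<close>.
\<close>

lemma matching_pmfs:
  fixes \<delta> :: real
  assumes \<delta>: "0 < \<delta>" "\<delta> \<le> 1 / 4" and r: "r \<ge> 1"
  shows "\<exists>U V :: real pmf. set_pmf U \<subseteq> {0..(real r)\<^sup>2} \<and> set_pmf V \<subseteq> {0..(real r)\<^sup>2} \<and>
    (\<forall>k\<le>r. measure_pmf.expectation U (\<lambda>x. x ^ k) = measure_pmf.expectation V (\<lambda>x. x ^ k)) \<and>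
    measure_pmf.expectation U (\<lambda>x. if x \<noteq> 0 then 1 else 0) \<le> 5 * \<delta> \<and>
    measure_pmf.expectation V (\<lambda>x. if x \<noteq> \<delta> / 4 then 1 else 0) \<le> 5 * \<delta> \<and>
    measure_pmf.expectation V (\<lambda>x. x) \<le> 10 * (\<delta> / 4) \<and>
    finite (set_pmf U) \<and> finite (set_pmf V)"
proof -
  \<comment> \<open>With b fixed and a proportional to \<delta>, the factor a b makes every atom
    small except those at 0 and a.\<close>
  define a b :: real where "a = \<delta> / 4" and "b = 1 / 4"
  define x where "x j = (real j - real r)\<^sup>2" for j
  \<comment> \<open>Dividing by the central binomial coefficient makes the weight at the atom 0,
    which is j = r, equal to 1 and all others at most 1 in absolute value.\<close>
  define c where "c j = (-1) ^ (j + r) * real (2 * r choose j) / real (2 * r choose r)" for j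
  have ab: "0 < a" "a < b" "b \<le> 1 / 2"
    using \<delta> by (auto simp: a_def b_def)
  have x_r: "x r = 0"
    by (simp add: x_def)
  have x_ge: "x j \<ge> 1" if "j \<noteq> r" for j
  proof -
    have "\<bar>real j - real r\<bar> \<ge> 1"
      using that by linarith
    then show ?thesis
      unfolding x_def using power_mono[of 1 "\<bar>real j - real r\<bar>" 2] by simp
  qed
  have x_neq: "x j \<noteq> t" if "0 < t" "t < 1" for j t
    using x_ge[of j] x_r that by (cases "j = r") auto
  have c_r: "c r = 1"
    by (simp add: c_def power_add[symmetric] mult_2[symmetric])
  have c_le: "\<bar>c j\<bar> \<le> 1" for j
    using binomial_maximum'[of r j] by (simp add: c_def abs_mult power_abs divide_le_eq_1)
  have c_mom: "(\<Sum>j\<le>2*r. c j * x j ^ k) = 0" if "k < r" for k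
  proof -
    have "(\<Sum>j\<le>2*r. c j * x j ^ k)
        = (-1) ^ r / real (2 * r choose r) * (\<Sum>j\<le>2*r. (-1) ^ j * real (2 * r choose j) * (- real r + real j) ^ (2 * k))"
      unfolding sum_distrib_left by (intro sum.cong refl) (simp add: c_def x_def power_add power_mult)
    then show ?thesis
      using alternating_binomial_power[of "2 * k" "2 * r" "- real r"] that by simp
  qed
  have quot: "\<bar>c j / (x j - t)\<bar> \<le> 2 / x j" if "j \<noteq> r" "0 < t" "t \<le> 1 / 2" for j t
  proof -
    have "\<bar>c j / (x j - t)\<bar> \<le> 1 / (x j - t)"
      using c_le[of j] x_ge[OF that(1)] that by (simp add: abs_divide divide_right_mono)
    also have "\<dots> \<le> 2 / x j"
      using x_ge[OF that(1)] that by (simp add: field_simps)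
    finally show ?thesis .
  qed
  have inv: "(\<Sum>j\<in>{..2*r} - {r}. 1 / x j) \<le> 4"
    unfolding x_def using sum_centred_squares[of "\<lambda>t. 1 / t" r] sum_inverse_squares_le[of r] by simp
  \<comment> \<open>The atom at 0 contributes - 1 / t and all others at most 8 together. For t = a
    this makes the compensating atom negative with weight near -1.\<close>
  have pole: "\<bar>(\<Sum>j\<le>2*r. c j / (x j - t)) + 1 / t\<bar> \<le> 8" if "0 < t" "t \<le> 1 / 2" for t
  proof -
    have "(\<Sum>j\<le>2*r. c j / (x j - t)) = - 1 / t + (\<Sum>j\<in>{..2*r} - {r}. c j / (x j - t))"
      by (subst sum.remove[of _ r]) (auto simp: c_r x_r)
    then have "\<bar>(\<Sum>j\<le>2*r. c j / (x j - t)) + 1 / t\<bar> \<le> (\<Sum>j\<in>{..2*r} - {r}. \<bar>c j / (x j - t)\<bar>)"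
      using sum_abs[of "\<lambda>j. c j / (x j - t)"] by simp
    also have "\<dots> \<le> (\<Sum>j\<in>{..2*r} - {r}. 2 * (1 / x j))"
      using quot that by (intro sum_mono) simp
    also have "\<dots> \<le> 8"
      unfolding sum_distrib_left[symmetric] using inv by simp
    finally show ?thesis .
  qed
  define A where "A t = (\<Sum>j\<le>2*r. c j / (x j - t))" for t
  define y where "y i = (if i \<le> 2 * r then x i else if i = 2 * r + 1 then a else b)" for i
  \<comment> \<open>The last two weights are the compensating atoms at a and b; the scaling by a b
    restores weight 1 at the atom 0.\<close>
  define W where "W i = (if i \<le> 2 * r then a * b * c i / ((x i - a) * (x i - b))
    else if i = 2 * r + 1 then a * b * A a / (b - a) else - (a * b * A b / (b - a)))" for i
  define I where "I = {..2 * r + 2}"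
  have sum_I: "(\<Sum>i\<in>I. g i) = (\<Sum>i\<le>2*r. g i) + g (2 * r + 1) + g (2 * r + 2)" for g :: "nat \<Rightarrow> real"
    by (simp add: I_def)
  have W_mom: "(\<Sum>i\<in>I. W i * y i ^ k) = 0" if "k \<le> r" for k
  proof -
    have t: "(\<Sum>j\<le>2*r. c j / (x j - t) * x j ^ k) = A t * t ^ k" if "0 < t" "t < 1" for t
      unfolding A_def by (rule moments_divide[of r]) (use c_mom x_neq that \<open>k \<le> r\<close> in auto)
    \<comment> \<open>Partial fractions reduce the double division to a difference of two single
      ones, to which \<open>t\<close> applies.\<close>
    have "(\<Sum>j\<le>2*r. W j * y j ^ k) = a * b / (a - b) *
        ((\<Sum>j\<le>2*r. c j / (x j - a) * x j ^ k) - (\<Sum>j\<le>2*r. c j / (x j - b) * x j ^ k))"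
      unfolding sum_subtractf[symmetric] sum_distrib_left
    proof (intro sum.cong refl)
      fix j assume "j \<in> {..2 * r}"
      have "x j - a \<noteq> 0" "x j - b \<noteq> 0" "a - b \<noteq> 0"
        using x_neq[of a j] x_neq[of b j] ab by auto
      then have "1 / ((x j - a) * (x j - b)) = (1 / (x j - a) - 1 / (x j - b)) / (a - b)"
        by (simp add: divide_simps)
      then have "a * b * c j * x j ^ k * (1 / ((x j - a) * (x j - b)))
          = a * b * c j * x j ^ k * ((1 / (x j - a) - 1 / (x j - b)) / (a - b))"
        by simp
      then show "W j * y j ^ k = a * b / (a - b) * (c j / (x j - a) * x j ^ k - c j / (x j - b) * x j ^ k)"
        using \<open>j \<in> _\<close> by (simp add: W_def y_def mult_ac right_diff_distrib diff_divide_distrib)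
    qed
    also have "(\<Sum>j\<le>2*r. c j / (x j - a) * x j ^ k) = A a * a ^ k"
      using ab by (intro t) auto
    also have "(\<Sum>j\<le>2*r. c j / (x j - b) * x j ^ k) = A b * b ^ k"
      using ab by (intro t) auto
    also have "a * b / (a - b) * (A a * a ^ k - A b * b ^ k)
        = - (W (2 * r + 1) * y (2 * r + 1) ^ k) - W (2 * r + 2) * y (2 * r + 2) ^ k"
    proof -
      have "a * b / (a - b) = - (a * b / (b - a))"
        by (metis minus_diff_eq minus_divide_right)
      then show ?thesis
        by (simp add: W_def y_def algebra_simps)
    qed
    finally show ?thesis
      unfolding sum_I by simp
  qed
  have W_r: "W r = 1"
    using ab by (simp add: W_def c_r x_r)
  have W_a: "W (2 * r + 1) \<le> 0" "- W (2 * r + 1) \<le> 2"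
  proof -
    have "\<bar>A a + 1 / a\<bar> \<le> 8"
      unfolding A_def using pole[of a] ab by simp
    then have "a * \<bar>A a + 1 / a\<bar> \<le> a * 8"
      using ab by (intro mult_left_mono) auto
    moreover have "\<bar>a * (A a + 1 / a)\<bar> = a * \<bar>A a + 1 / a\<bar>"
      using ab by (simp add: abs_mult)
    moreover have "a * (A a + 1 / a) = a * A a + 1"
      using ab by (simp add: distrib_left)
    ultimately have *: "\<bar>a * A a + 1\<bar> \<le> 8 * a"
      by simp
    have W: "W (2 * r + 1) = (a * A a) * (b / (b - a))"
      by (simp add: W_def)
    have "b / (b - a) = 1 / (1 - \<delta>)"
      using \<delta> ab by (simp add: a_def b_def field_simps)
    then have "W (2 * r + 1) = (a * A a) / (1 - \<delta>)"
      unfolding W by simp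
    moreover have "- (a * A a) \<le> 2 * (1 - \<delta>)" "a * A a \<le> 0"
      using * \<delta> by (auto simp: a_def abs_le_iff)
    ultimately show "W (2 * r + 1) \<le> 0" "- W (2 * r + 1) \<le> 2"
      using \<delta> by (simp_all add: divide_nonpos_pos minus_divide_left pos_divide_le_eq del: minus_divide_left[symmetric])
  qed
  have W_b: "\<bar>W (2 * r + 2)\<bar> \<le> 4 * \<delta>"
  proof -
    have "\<bar>A b + 1 / b\<bar> \<le> 8"
      unfolding A_def using pole[of b] ab by simp
    then have "\<bar>A b\<bar> \<le> 12"
      by (simp add: b_def)
    moreover have "\<bar>W (2 * r + 2)\<bar> = (\<delta> / 4) / (1 - \<delta>) * \<bar>A b\<bar>"
      using \<delta> by (simp add: W_def a_def b_def abs_mult field_simps)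
    moreover have "(\<delta> / 4) / (1 - \<delta>) \<le> \<delta> / 3"
      using \<delta> by (simp add: field_simps)
    ultimately have "\<bar>W (2 * r + 2)\<bar> \<le> \<delta> / 3 * 12"
      using \<delta> by (metis abs_ge_zero divide_nonneg_nonneg less_imp_le mult_mono zero_le_numeral)
    then show ?thesis
      by simp
  qed
  \<comment> \<open>Each division contributes a decay of 1 / x. After only one, the weight times x
    would be comparable to a times |c j|, whose sum grows with r.\<close>
  have W_sq: "\<bar>W j\<bar> * x j \<le> \<delta> / 4 * (1 / x j)" if "j \<le> 2 * r" "j \<noteq> r" for j
  proof -
    have x: "x j \<ge> 1"
      using x_ge that by simp
    have "\<bar>W j\<bar> = a * b * \<bar>c j / (x j - a)\<bar> * (1 / (x j - b))"
      using x ab that by (simp add: W_def abs_mult abs_divide)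
    also have "\<dots> \<le> a * b * (2 / x j) * (2 / x j)"
      using quot[of j a] x ab that by (intro mult_mono) (auto simp: field_simps)
    finally show ?thesis
      using x by (simp add: a_def b_def field_simps)
  qed
  have x_W: "\<bar>W j\<bar> \<le> \<bar>W j\<bar> * x j" if "j \<noteq> r" for j
    using x_ge[OF that] by (simp add: mult_le_cancel_left1)
  have sum_sq: "(\<Sum>j\<in>{..2*r} - {r}. \<bar>W j\<bar> * x j) \<le> \<delta>"
  proof -
    have "(\<Sum>j\<in>{..2*r} - {r}. \<bar>W j\<bar> * x j) \<le> (\<Sum>j\<in>{..2*r} - {r}. \<delta> / 4 * (1 / x j))"
      using W_sq by (intro sum_mono) auto
    also have "\<dots> \<le> \<delta>"
      unfolding sum_distrib_left[symmetric] using inv \<delta> by (simp add: mult_left_mono[of _ 4, simplified])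
    finally show ?thesis .
  qed
  have sum_split: "(\<Sum>i\<in>I. g i) = g r + (\<Sum>i\<in>{..2*r} - {r}. g i) + g (2 * r + 1) + g (2 * r + 2)"
    for g :: "nat \<Rightarrow> real"
    unfolding sum_I by (subst sum.remove[of _ r]) auto
  have fin: "finite I"
    by (simp add: I_def)
  have big: "1 \<le> (\<Sum>i\<in>I. max (W i) 0)"
    using member_le_sum[of r I "\<lambda>i. max (W i) 0"] W_r by (simp add: I_def)
  have "\<forall>k\<le>r. (\<Sum>i\<in>I. W i * y i ^ k) = 0"
    using W_mom by blast
  from signed_measure_split[OF fin this big] obtain U V :: "real pmf"
    where UV: "set_pmf U \<subseteq> y ` I" "set_pmf V \<subseteq> y ` I"
      "\<forall>k\<le>r. measure_pmf.expectation U (\<lambda>x. x ^ k) = measure_pmf.expectation V (\<lambda>x. x ^ k)"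
    and ex: "\<forall>f :: real \<Rightarrow> real. (\<forall>i\<in>I. 0 \<le> f (y i)) \<longrightarrow>
      measure_pmf.expectation U f \<le> (\<Sum>i\<in>I. max (W i) 0 * f (y i)) \<and>
      measure_pmf.expectation V f \<le> (\<Sum>i\<in>I. max (- W i) 0 * f (y i))"
    by (elim exE conjE) (rule that)
  have y_range: "0 \<le> y i \<and> y i \<le> (real r)\<^sup>2" if "i \<in> I" for i
  proof -
    have "(1 :: real) \<le> (real r)\<^sup>2"
      using r by simp
    moreover have "x i \<le> (real r)\<^sup>2" if "i \<le> 2 * r"
    proof -
      have "\<bar>real i - real r\<bar> \<le> real r"
        using that by linarith
      then show ?thesis
        unfolding x_def using power_mono[of "\<bar>real i - real r\<bar>" "real r" 2] by simp
    qed
    ultimately show ?thesis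
      using ab by (auto simp: y_def x_def)
  qed
  have small: "max t 0 \<le> \<bar>t\<bar>" "max (- t) 0 \<le> \<bar>t\<bar>" for t :: real
    by (auto simp: max_def)
  have small_sum: "(\<Sum>i\<in>{..2*r} - {r}. g i) \<le> (\<Sum>j\<in>{..2*r} - {r}. \<bar>W j\<bar> * x j)"
    if "\<And>i. i \<le> 2 * r \<Longrightarrow> i \<noteq> r \<Longrightarrow> g i \<le> \<bar>W i\<bar> * x i" for g
    using that by (intro sum_mono) auto
  have "measure_pmf.expectation U (\<lambda>x. if x \<noteq> 0 then 1 else 0)
      \<le> (\<Sum>i\<in>I. max (W i) 0 * (if y i \<noteq> 0 then 1 else 0))"
    using ex[rule_format, of "\<lambda>x. if x \<noteq> 0 then 1 else 0"] by simp
  also have "\<dots> \<le> \<delta> + \<bar>W (2 * r + 2)\<bar>"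
  proof -
    have "(\<Sum>i\<in>{..2*r} - {r}. max (W i) 0 * (if y i \<noteq> 0 then 1 else 0)) \<le> \<delta>"
      using small_sum[of "\<lambda>i. max (W i) 0 * (if y i \<noteq> 0 then 1 else 0)"] x_W small sum_sq
      by (smt (verit) mult_cancel_left1 mult_cancel_right1 abs_ge_zero)
    moreover have "y r = 0" "max (W (2 * r + 1)) 0 = 0"
      using W_a by (auto simp: y_def x_r)
    moreover have "max (W (2 * r + 2)) 0 * (if y (2 * r + 2) \<noteq> 0 then 1 else 0) \<le> \<bar>W (2 * r + 2)\<bar>"
      using small(1)[of "W (2 * r + 2)"] by simp
    ultimately show ?thesis
      unfolding sum_split by simp
  qed
  finally have U0: "measure_pmf.expectation U (\<lambda>x. if x \<noteq> 0 then 1 else 0) \<le> 5 * \<delta>"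
    using W_b by simp
  have "measure_pmf.expectation V (\<lambda>x. if x \<noteq> \<delta> / 4 then 1 else 0)
      \<le> (\<Sum>i\<in>I. max (- W i) 0 * (if y i \<noteq> \<delta> / 4 then 1 else 0))"
    using ex[rule_format, of "\<lambda>x. if x \<noteq> \<delta> / 4 then 1 else 0"] by simp
  also have "\<dots> \<le> \<delta> + \<bar>W (2 * r + 2)\<bar>"
  proof -
    have "(\<Sum>i\<in>{..2*r} - {r}. max (- W i) 0 * (if y i \<noteq> \<delta> / 4 then 1 else 0)) \<le> \<delta>"
      using small_sum[of "\<lambda>i. max (- W i) 0 * (if y i \<noteq> \<delta> / 4 then 1 else 0)"] x_W small sum_sq
      by (smt (verit) mult_cancel_left1 mult_cancel_right1 abs_ge_zero)
    moreover have "y (2 * r + 1) = \<delta> / 4" "max (- W r) 0 = 0"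
      by (auto simp: y_def a_def W_r)
    moreover have "max (- W (2 * r + 2)) 0 * (if y (2 * r + 2) \<noteq> \<delta> / 4 then 1 else 0) \<le> \<bar>W (2 * r + 2)\<bar>"
      using small(2)[of "W (2 * r + 2)"] by simp
    ultimately show ?thesis
      unfolding sum_split by simp
  qed
  finally have Va: "measure_pmf.expectation V (\<lambda>x. if x \<noteq> \<delta> / 4 then 1 else 0) \<le> 5 * \<delta>"
    using W_b by simp
  have "measure_pmf.expectation V (\<lambda>x. x) \<le> (\<Sum>i\<in>I. max (- W i) 0 * y i)"
    using ex[rule_format, of "\<lambda>x. x"] y_range by simp
  also have "\<dots> \<le> \<delta> + 2 * a + \<bar>W (2 * r + 2)\<bar> * b"
  proof -
    have "(\<Sum>i\<in>{..2*r} - {r}. max (- W i) 0 * y i) \<le> \<delta>"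
    proof (rule order_trans[OF small_sum sum_sq])
      fix i assume "i \<le> 2 * r" "i \<noteq> r"
      then show "max (- W i) 0 * y i \<le> \<bar>W i\<bar> * x i"
        using small(2)[of "W i"] x_ge[of i] by (simp add: y_def mult_right_mono)
    qed
    moreover have "max (- W (2 * r + 1)) 0 * a \<le> 2 * a"
      using W_a(2) ab by (intro mult_right_mono) auto
    moreover have "max (- W (2 * r + 2)) 0 * b \<le> \<bar>W (2 * r + 2)\<bar> * b"
      using small(2) ab by (intro mult_right_mono) auto
    moreover have "max (- W r) 0 = 0"
      by (simp add: W_r)
    ultimately show ?thesis
      unfolding sum_split by (simp add: y_def)
  qed
  also have "\<dots> \<le> 10 * (\<delta> / 4)"
    using W_b by (simp add: a_def b_def)
  finally have mean: "measure_pmf.expectation V (\<lambda>x. x) \<le> 10 * (\<delta> / 4)" .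
  have "y ` I \<subseteq> {0..(real r)\<^sup>2}" "finite (y ` I)"
    using y_range fin by auto
  then have "set_pmf U \<subseteq> {0..(real r)\<^sup>2}" "set_pmf V \<subseteq> {0..(real r)\<^sup>2}"
    "finite (set_pmf U)" "finite (set_pmf V)"
    using UV(1,2) finite_subset by blast+
  then show ?thesis
    using UV(3) U0 Va mean by blast
qed

section \<open>Acceptance probabilities as polynomials\<close>

text \<open>
  Moving mass \<open>s\<close> from the point \<open>d\<close> to the point \<open>i\<close> changes the acceptance probability
  polynomially; the \<open>j\<close>-th coefficient is \<open>q choose j\<close> times a \<open>j\<close>-fold difference of probabilities.
\<close>

lemma run_query_tester_polynomial:
  fixes D :: "real \<Rightarrow> 'a pmf"
  assumes "cost_at_most X q t" and X: "finite X" "i \<in> X" "d \<in> X" and f: "\<And>x. x \<in> X \<Longrightarrow> f x \<in> {-1, 1}"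
    and D: "\<And>s. s \<in> T \<Longrightarrow> set_pmf (D s) \<subseteq> X"
      "\<And>s x. s \<in> T \<Longrightarrow> pmf (D s) x = \<beta> x + s * ((if x = i then 1 else 0) - (if x = d then 1 else 0))"
    and \<beta>: "\<And>x. x \<in> X \<Longrightarrow> 0 \<le> \<beta> x" "(\<Sum>x\<in>X. \<beta> x) = 1"
  shows "\<exists>c. (\<forall>j. \<bar>c j\<bar> \<le> real (q choose j) * 2 ^ j) \<and>
    (\<forall>s\<in>T. pmf (run_query_tester t (D s) f) True = (\<Sum>j\<le>q. c j * s ^ j))"
  using assms(1)
proof induction
  case (1 q b)
  define c :: "nat \<Rightarrow> real" where "c j = (if j = 0 then of_bool b else 0)" for j
  have "(\<Sum>j\<le>q. c j * s ^ j) = (\<Sum>j\<in>{0}. c j * s ^ j)" for s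
    by (intro sum.mono_neutral_right) (auto simp: c_def)
  then show ?case
    by (intro exI[of _ c]) (simp add: c_def)
next
  case (2 x q k)
  from 2(3)[OF f[OF \<open>x \<in> X\<close>]] obtain c where c: "\<forall>j. \<bar>c j\<bar> \<le> real (q choose j) * 2 ^ j"
    "\<forall>s\<in>T. pmf (run_query_tester (k (f x)) (D s) f) True = (\<Sum>j\<le>q. c j * s ^ j)"
    by (elim exE conjE) (rule that)
  have "\<bar>c j\<bar> \<le> real (Suc q choose j) * 2 ^ j" for j
  proof -
    have "real (q choose j) * 2 ^ j \<le> real (Suc q choose j) * 2 ^ j"
      by (intro mult_right_mono) (simp_all add: binomial_right_mono)
    then show ?thesis
      using c(1) order_trans by blast
  qed
  \<comment> \<open>A query reveals a value of the fixed \<open>f\<close> and therefore does not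
    raise the degree.\<close>
  moreover have "c (Suc q) = 0"
    using c(1)[rule_format, of "Suc q"] by (simp add: binomial_eq_0)
  ultimately show ?case
    using c(2) by (intro exI[of _ c]) simp
next
  case (3 q k)
  then have "\<forall>x\<in>X. \<exists>c. (\<forall>j. \<bar>c j\<bar> \<le> real (q choose j) * 2 ^ j) \<and>
      (\<forall>s\<in>T. pmf (run_query_tester (k x (f x)) (D s) f) True = (\<Sum>j\<le>q. c j * s ^ j))"
    using f by blast
  from bchoice[OF this] obtain c where c: "\<forall>x\<in>X. (\<forall>j. \<bar>c x j\<bar> \<le> real (q choose j) * 2 ^ j) \<and>
      (\<forall>s\<in>T. pmf (run_query_tester (k x (f x)) (D s) f) True = (\<Sum>j\<le>q. c x j * s ^ j))"
    by (elim exE) (rule that)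
  then have c_le: "\<bar>c x j\<bar> \<le> real (q choose j) * 2 ^ j" if "x \<in> X" for x j
    using that by blast
  \<comment> \<open>The drawn point contributes an average over \<beta>, which keeps degree and
    bounds, and s times a difference of two continuations, which shifts the degree by one and
    doubles the bound. Pascal's rule adds the two bounds.\<close>
  define e g where "e j = (\<Sum>x\<in>X. \<beta> x * c x j)" and "g j = c i j - c d j" for j
  define c' where "c' j = e j + (if j = 0 then 0 else g (j - 1))" for j
  have e_le: "\<bar>e j\<bar> \<le> real (q choose j) * 2 ^ j" for j
  proof -
    have "\<bar>e j\<bar> \<le> (\<Sum>x\<in>X. \<bar>\<beta> x * c x j\<bar>)"
      unfolding e_def by (rule sum_abs)
    also have "\<dots> \<le> (\<Sum>x\<in>X. \<beta> x * (real (q choose j) * 2 ^ j))"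
      using \<beta>(1) c_le by (intro sum_mono) (simp add: abs_mult mult_left_mono)
    also have "\<dots> = real (q choose j) * 2 ^ j"
      unfolding sum_distrib_right[symmetric] by (simp add: \<beta>(2))
    finally show ?thesis .
  qed
  have g_le: "\<bar>g j\<bar> \<le> real (q choose j) * 2 ^ Suc j" for j
    using c_le[OF X(2), of j] c_le[OF X(3), of j] by (simp add: g_def)
  have "\<bar>c' j\<bar> \<le> real (Suc q choose j) * 2 ^ j" for j
  proof (cases j)
    case 0
    then show ?thesis
      using e_le[of 0] by (simp add: c'_def)
  next
    case (Suc l)
    then show ?thesis
      using e_le[of "Suc l"] g_le[of l] by (simp add: c'_def algebra_simps)
  qed
  moreover have "pmf (run_query_tester (Sample k) (D s) f) True = (\<Sum>j\<le>Suc q. c' j * s ^ j)" if s: "s \<in> T" for s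
  proof -
    define h where "h x = (\<Sum>j\<le>q. c x j * s ^ j)" for x
    have "pmf (run_query_tester (Sample k) (D s) f) True
        = measure_pmf.expectation (D s) (\<lambda>x. pmf (run_query_tester (k x (f x)) (D s) f) True)"
      by (simp add: pmf_bind)
    also have "\<dots> = (\<Sum>x\<in>X. pmf (run_query_tester (k x (f x)) (D s) f) True * pmf (D s) x)"
      using D(1)[OF s] X(1) by (intro integral_measure_pmf_real) auto
    also have "\<dots> = (\<Sum>x\<in>X. h x * (\<beta> x + s * ((if x = i then 1 else 0) - (if x = d then 1 else 0))))"
      using c s by (intro sum.cong refl) (simp add: D(2) h_def)
    also have "\<dots> = (\<Sum>x\<in>X. \<beta> x * h x) + s * ((\<Sum>x\<in>X. if x = i then h x else 0) - (\<Sum>x\<in>X. if x = d then h x else 0))"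
      unfolding sum_subtractf[symmetric] sum_distrib_left sum.distrib[symmetric]
      by (intro sum.cong refl) (simp add: algebra_simps)
    also have "\<dots> = (\<Sum>x\<in>X. \<beta> x * h x) + s * (h i - h d)"
      using X by simp
    also have "(\<Sum>x\<in>X. \<beta> x * h x) = (\<Sum>j\<le>q. e j * s ^ j)"
      unfolding h_def e_def sum_distrib_left sum_distrib_right by (subst sum.swap) (simp add: mult.assoc)
    also have "h i - h d = (\<Sum>j\<le>q. g j * s ^ j)"
      by (simp add: h_def g_def left_diff_distrib sum_subtractf)
    also have "(\<Sum>j\<le>q. e j * s ^ j) + s * (\<Sum>j\<le>q. g j * s ^ j) = (\<Sum>j\<le>Suc q. c' j * s ^ j)"
    proof -
      have "(\<Sum>j\<le>Suc q. c' j * s ^ j)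
          = (\<Sum>j\<le>Suc q. e j * s ^ j) + (\<Sum>j\<le>Suc q. (if j = 0 then 0 else g (j - 1)) * s ^ j)"
        unfolding sum.distrib[symmetric] by (simp add: c'_def distrib_right del: sum.atMost_Suc)
      also have "(\<Sum>j\<le>Suc q. (if j = 0 then 0 else g (j - 1)) * s ^ j) = s * (\<Sum>j\<le>q. g j * s ^ j)"
        unfolding sum.atMost_Suc_shift sum_distrib_left by (simp add: mult_ac)
      finally show ?thesis
        using e_le[of "Suc q"] by (simp add: binomial_eq_0)
    qed
    finally show ?thesis .
  qed
  ultimately show ?case
    by blast
next
  case (4 p q)
  then have "\<forall>t\<in>set_pmf p. \<exists>c. (\<forall>j. \<bar>c j\<bar> \<le> real (q choose j) * 2 ^ j) \<and>
      (\<forall>s\<in>T. pmf (run_query_tester t (D s) f) True = (\<Sum>j\<le>q. c j * s ^ j))"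
    by blast
  from bchoice[OF this] obtain c where c: "\<forall>t\<in>set_pmf p. (\<forall>j. \<bar>c t j\<bar> \<le> real (q choose j) * 2 ^ j) \<and>
      (\<forall>s\<in>T. pmf (run_query_tester t (D s) f) True = (\<Sum>j\<le>q. c t j * s ^ j))"
    by (elim exE) (rule that)
  \<comment> \<open>The coefficient bound is uniform over the outcomes of the toss, so averaging is
    legitimate even if \<open>p\<close> has infinite support.\<close>
  have int: "integrable (measure_pmf p) (\<lambda>t. c t j)" for j
    using c by (intro measure_pmf.integrable_const_bound[where B = "real (q choose j) * 2 ^ j"])
      (auto simp: AE_measure_pmf_iff)
  define c' where "c' j = measure_pmf.expectation p (\<lambda>t. c t j)" for j
  have "\<bar>c' j\<bar> \<le> real (q choose j) * 2 ^ j" for j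
  proof -
    have "\<bar>c' j\<bar> \<le> measure_pmf.expectation p (\<lambda>t. \<bar>c t j\<bar>)"
      unfolding c'_def by (rule integral_abs_bound)
    also have "\<dots> \<le> real (q choose j) * 2 ^ j"
      using c int by (intro measure_pmf.integral_le_const integrable_abs) (auto simp: AE_measure_pmf_iff)
    finally show ?thesis .
  qed
  moreover have "pmf (run_query_tester (Toss p) (D s) f) True = (\<Sum>j\<le>q. c' j * s ^ j)" if "s \<in> T" for s
  proof -
    have "pmf (run_query_tester (Toss p) (D s) f) True
        = measure_pmf.expectation p (\<lambda>t. pmf (run_query_tester t (D s) f) True)"
      by (simp add: pmf_bind)
    also have "\<dots> = measure_pmf.expectation p (\<lambda>t. \<Sum>j\<le>q. c t j * s ^ j)"
      using c that by (intro integral_cong_AE) (auto simp: AE_measure_pmf_iff)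
    also have "\<dots> = (\<Sum>j\<le>q. c' j * s ^ j)"
      unfolding c'_def using int by (subst Bochner_Integration.integral_sum) auto
    finally show ?thesis .
  qed
  ultimately show ?case
    by blast
qed

section \<open>Sample testers as trees, and distributions given by random weights\<close>

primrec sample_tree :: "'a sample_tester \<Rightarrow> nat \<Rightarrow> ('a \<times> real) list \<Rightarrow> 'a query_tester" where
  "sample_tree T 0 acc = Toss (map_pmf Verdict (T acc))"
| "sample_tree T (Suc m) acc = Sample (\<lambda>x y. sample_tree T m (acc @ [(x, y)]))"

lemma run_sample_tree:
  "run_query_tester (sample_tree T m acc) D f = bind_pmf (replicate_pmf m D) (\<lambda>xs. T (acc @ map (\<lambda>x. (x, f x)) xs))"
  by (induction m arbitrary: acc)
    (simp_all add: bind_map_pmf bind_return_pmf bind_return_pmf' bind_assoc_pmf)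

lemma cost_sample_tree: "cost_at_most X m (sample_tree T m acc)"
proof (induction m arbitrary: acc)
  case 0
  show ?case
    by (auto intro!: cost_at_most.intros)
next
  case (Suc m)
  then show ?case
    by (auto intro: cost_at_most.intros)
qed

text \<open>
  The point \<open>d\<close> absorbs the mass that is left over, so no normalisation is needed. The value is
  meaningful only if \<open>sum u I \<le> M\<close>.
\<close>

definition spread :: "real \<Rightarrow> 'a \<Rightarrow> 'a set \<Rightarrow> ('a \<Rightarrow> real) \<Rightarrow> 'a pmf" where
  "spread M d I u = embed_pmf (\<lambda>z. if z \<in> I then u z / M else if z = d then 1 - sum u I / M else 0)"

lemma pmf_spread:
  assumes "finite I" "d \<notin> I" "M > 0" "\<And>z. z \<in> I \<Longrightarrow> u z \<ge> 0" "sum u I \<le> M"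
  shows "pmf (spread M d I u) z = (if z \<in> I then u z / M else if z = d then 1 - sum u I / M else 0)"
proof -
  define w where "w z = (if z \<in> I then u z / M else if z = d then 1 - sum u I / M else 0)" for z
  have nonneg: "w z \<ge> 0" for z
    using assms by (simp add: w_def)
  have "(\<integral>\<^sup>+ z. ennreal (w z) \<partial>count_space UNIV) = (\<Sum>z\<in>insert d I. ennreal (w z))"
    using assms(1) by (intro nn_integral_count_space'[of "insert d I"]) (auto simp: w_def)
  also have "\<dots> = ennreal (\<Sum>z\<in>insert d I. w z)"
    using nonneg by (intro sum_ennreal) auto
  also have "(\<Sum>z\<in>insert d I. w z) = 1"
    using assms(1,2) by (simp add: w_def sum_divide_distrib)
  finally have "pmf (embed_pmf w) z = w z"
    using nonneg by (intro pmf_embed_pmf) auto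
  moreover have "spread M d I u = embed_pmf w"
    unfolding spread_def w_def ..
  ultimately show ?thesis
    by (simp add: w_def)
qed

lemma set_spread:
  assumes "finite I" "d \<notin> I" "M > 0" "\<And>z. z \<in> I \<Longrightarrow> u z \<ge> 0" "sum u I \<le> M"
  shows "set_pmf (spread M d I u) \<subseteq> insert d {z \<in> I. u z \<noteq> 0}"
  using assms by (auto simp: set_pmf_eq pmf_spread split: if_splits)

text \<open>Outside the meaningful range the value 0 counts as rejection. It helps the upper bound
  for V, and in the lower bound for U it is charged to the event that the total exceeds M.\<close>

definition spread_accept :: "'a query_tester \<Rightarrow> ('a \<Rightarrow> real) \<Rightarrow> real \<Rightarrow> 'a \<Rightarrow> 'a set \<Rightarrow> ('a \<Rightarrow> real) \<Rightarrow> real" where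
  "spread_accept t f M d I u =
     (if sum u I \<le> M then pmf (run_query_tester t (spread M d I u) f) True else 0)"

lemma spread_accept_bounds: "0 \<le> spread_accept t f M d I u" "spread_accept t f M d I u \<le> 1"
  by (simp_all add: spread_accept_def pmf_le_1)

text \<open>In a single weight the acceptance probability is a polynomial, so moments up to r
  cancel. The slack B in the bound on the other weights keeps the total at most M for every value of
  the replaced one.\<close>

lemma spread_accept_replace_one:
  fixes P Q :: "real pmf"
  assumes cost: "cost_at_most X q t" and X: "finite X" "I \<subseteq> X" "d \<in> X" "d \<notin> I" "i \<in> I"
    and f: "\<And>x. x \<in> X \<Longrightarrow> f x \<in> {-1, 1}" and "M > 0"
    and PQ: "set_pmf P \<subseteq> {0..B}" "set_pmf Q \<subseteq> {0..B}" "finite (set_pmf P)" "finite (set_pmf Q)"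
    and mom: "\<And>k. k \<le> r \<Longrightarrow> measure_pmf.expectation P (\<lambda>x. x ^ k) = measure_pmf.expectation Q (\<lambda>x. x ^ k)"
    and u: "\<And>j. j \<in> I - {i} \<Longrightarrow> 0 \<le> u j" "sum u (I - {i}) \<le> M - B" and "B \<ge> 0"
  shows "\<bar>measure_pmf.expectation P (\<lambda>x. spread_accept t f M d I (u(i := x)))
      - measure_pmf.expectation Q (\<lambda>x. spread_accept t f M d I (u(i := x)))\<bar>
    \<le> (\<Sum>j\<in>{r<..q}. real (q choose j) * (2 * B / M) ^ j)"
proof -
  have fin: "finite I"
    using X finite_subset by blast
  have sum_upd: "sum (u(i := x)) I = x + sum u (I - {i})" for x
    using fin \<open>i \<in> I\<close> by (subst sum.remove[of _ i]) (auto intro: sum.cong)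
  have valid: "sum (u(i := x)) I \<le> M" if "x \<in> {0..B}" for x
    unfolding sum_upd using u(2) that by simp
  have nonneg: "(u(i := x)) z \<ge> 0" if "x \<in> {0..B}" "z \<in> I" for x z
    using u(1)[of z] that by (cases "z = i") auto
  \<comment> \<open>This is the distribution with weight zero at \<open>i\<close>; the parameter s =
    x / M then moves mass from \<open>d\<close> to \<open>i\<close>.\<close>
  define \<beta> where "\<beta> z = (if z \<in> I - {i} then u z / M else if z = d then 1 - sum u (I - {i}) / M else 0)" for z
  define D where "D s = spread M d I (u(i := s * M))" for s
  have D: "set_pmf (D s) \<subseteq> X"
      "pmf (D s) z = \<beta> z + s * ((if z = i then 1 else 0) - (if z = d then 1 else 0))"
    if "s \<in> {0..B / M}" for s z
  proof -
    have s: "s * M \<in> {0..B}"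
      using that \<open>M > 0\<close> by (auto simp: field_simps)
    show "set_pmf (D s) \<subseteq> X"
      unfolding D_def using set_spread[OF fin \<open>d \<notin> I\<close> \<open>M > 0\<close> nonneg[OF s] valid[OF s]] X by blast
    have "pmf (D s) z = (if z \<in> I then (u(i := s * M)) z / M else if z = d then 1 - sum (u(i := s * M)) I / M else 0)"
      unfolding D_def by (rule pmf_spread[OF fin \<open>d \<notin> I\<close> \<open>M > 0\<close> nonneg[OF s] valid[OF s]])
    then show "pmf (D s) z = \<beta> z + s * ((if z = i then 1 else 0) - (if z = d then 1 else 0))"
      using \<open>M > 0\<close> \<open>i \<in> I\<close> \<open>d \<notin> I\<close> unfolding sum_upd by (auto simp: \<beta>_def add_divide_distrib)
  qed
  have \<beta>_nonneg: "0 \<le> \<beta> z" for z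
    using u \<open>M > 0\<close> \<open>B \<ge> 0\<close> by (simp add: \<beta>_def)
  have "(\<Sum>z\<in>X. \<beta> z) = (\<Sum>z\<in>insert d (I - {i}). \<beta> z)"
    using X by (intro sum.mono_neutral_right) (auto simp: \<beta>_def)
  also have "\<dots> = 1"
    using fin \<open>d \<notin> I\<close> by (simp add: \<beta>_def sum_divide_distrib)
  finally have \<beta>_sum: "(\<Sum>z\<in>X. \<beta> z) = 1" .
  have "i \<in> X"
    using X by blast
  have "\<exists>c. (\<forall>j. \<bar>c j\<bar> \<le> real (q choose j) * 2 ^ j) \<and>
      (\<forall>s\<in>{0..B / M}. pmf (run_query_tester t (D s) f) True = (\<Sum>j\<le>q. c j * s ^ j))"
    by (rule run_query_tester_polynomial[where f = f and D = D and T = "{0..B / M}",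
          OF cost X(1) \<open>i \<in> X\<close> X(3) f D \<beta>_nonneg \<beta>_sum])
  then obtain c where c: "\<forall>j. \<bar>c j\<bar> \<le> real (q choose j) * 2 ^ j"
    "\<forall>s\<in>{0..B / M}. pmf (run_query_tester t (D s) f) True = (\<Sum>j\<le>q. c j * s ^ j)"
    by (elim exE conjE) (rule that)
  have acc: "spread_accept t f M d I (u(i := x)) = (\<Sum>j\<le>q. c j / M ^ j * x ^ j)" if "x \<in> {0..B}" for x
  proof -
    have "x / M \<in> {0..B / M}"
      using that \<open>M > 0\<close> by (auto simp: divide_right_mono)
    then have "pmf (run_query_tester t (D (x / M)) f) True = (\<Sum>j\<le>q. c j * (x / M) ^ j)"
      using c(2) by blast
    then show ?thesis
      using valid[OF that] \<open>M > 0\<close> by (simp add: spread_accept_def D_def power_divide)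
  qed
  have E: "measure_pmf.expectation R (\<lambda>x. spread_accept t f M d I (u(i := x)))
      = (\<Sum>j\<le>q. c j / M ^ j * measure_pmf.expectation R (\<lambda>x. x ^ j))"
    if "set_pmf R \<subseteq> {0..B}" "finite (set_pmf R)" for R
  proof -
    have "measure_pmf.expectation R (\<lambda>x. spread_accept t f M d I (u(i := x)))
        = measure_pmf.expectation R (\<lambda>x. \<Sum>j\<le>q. c j / M ^ j * x ^ j)"
      using acc that(1) by (intro integral_cong_AE) (auto simp: AE_measure_pmf_iff)
    also have "\<dots> = (\<Sum>j\<le>q. c j / M ^ j * measure_pmf.expectation R (\<lambda>x. x ^ j))"
      using that(2) by (subst Bochner_Integration.integral_sum) (auto intro!: integrable_measure_pmf_finite)
    finally show ?thesis .
  qed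
  have range: "measure_pmf.expectation R (\<lambda>x. x ^ j) \<in> {0..B ^ j}"
    if "set_pmf R \<subseteq> {0..B}" "finite (set_pmf R)" for R j
  proof -
    have pw: "0 \<le> x ^ j \<and> x ^ j \<le> B ^ j" if "x \<in> set_pmf R" for x
    proof -
      have "0 \<le> x" "x \<le> B"
        using that \<open>set_pmf R \<subseteq> {0..B}\<close> by auto
      then show ?thesis
        by (simp add: power_mono)
    qed
    have "measure_pmf.expectation R (\<lambda>x. x ^ j) \<le> B ^ j"
      using pw that(2) by (intro measure_pmf.integral_le_const integrable_measure_pmf_finite) (auto simp: AE_measure_pmf_iff)
    moreover have "0 \<le> measure_pmf.expectation R (\<lambda>x. x ^ j)"
      using pw by (intro integral_nonneg_AE) (auto simp: AE_measure_pmf_iff)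
    ultimately show ?thesis
      by simp
  qed
  have "\<bar>measure_pmf.expectation P (\<lambda>x. spread_accept t f M d I (u(i := x)))
      - measure_pmf.expectation Q (\<lambda>x. spread_accept t f M d I (u(i := x)))\<bar>
    = \<bar>\<Sum>j\<le>q. c j / M ^ j * (measure_pmf.expectation P (\<lambda>x. x ^ j) - measure_pmf.expectation Q (\<lambda>x. x ^ j))\<bar>"
    unfolding E[OF PQ(1,3)] E[OF PQ(2,4)] by (simp add: sum_subtractf right_diff_distrib)
  also have "\<dots> = \<bar>\<Sum>j\<in>{r<..q}. c j / M ^ j * (measure_pmf.expectation P (\<lambda>x. x ^ j) - measure_pmf.expectation Q (\<lambda>x. x ^ j))\<bar>"
    using mom by (intro arg_cong[of _ _ abs] sum.mono_neutral_right) auto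
  also have "\<dots> \<le> (\<Sum>j\<in>{r<..q}. \<bar>c j / M ^ j * (measure_pmf.expectation P (\<lambda>x. x ^ j) - measure_pmf.expectation Q (\<lambda>x. x ^ j))\<bar>)"
    by (rule sum_abs)
  also have "\<dots> \<le> (\<Sum>j\<in>{r<..q}. (real (q choose j) * 2 ^ j) / M ^ j * B ^ j)"
  proof (intro sum_mono)
    fix j
    \<comment> \<open>Both moments lie between 0 and B^j, so their difference costs no factor
      2.\<close>
    have "\<bar>measure_pmf.expectation P (\<lambda>x. x ^ j) - measure_pmf.expectation Q (\<lambda>x. x ^ j)\<bar> \<le> B ^ j"
      using range[OF PQ(1,3), of j] range[OF PQ(2,4), of j] by (auto simp: abs_le_iff)
    then show "\<bar>c j / M ^ j * (measure_pmf.expectation P (\<lambda>x. x ^ j) - measure_pmf.expectation Q (\<lambda>x. x ^ j))\<bar>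
        \<le> (real (q choose j) * 2 ^ j) / M ^ j * B ^ j"
      unfolding abs_mult using c(1) \<open>M > 0\<close> by (intro mult_mono) (auto simp: abs_divide intro: divide_right_mono)
  qed
  also have "\<dots> = (\<Sum>j\<in>{r<..q}. real (q choose j) * (2 * B / M) ^ j)"
    by (intro sum.cong refl) (simp add: power_divide power_mult_distrib)
  finally show ?thesis .
qed

section \<open>Products of independent weights\<close>

lemma finite_set_Pi_pmf:
  assumes "finite I" "\<And>i. i \<in> I \<Longrightarrow> finite (set_pmf (R i))"
  shows "finite (set_pmf (Pi_pmf I dflt R))"
  using assms by (simp add: set_Pi_pmf finite_PiE_dflt)

lemma expectation_Pi_pmf_split:
  fixes G :: "('i \<Rightarrow> 'b) \<Rightarrow> real"
  assumes "finite I" "i \<in> I" "\<And>j. j \<in> I \<Longrightarrow> finite (set_pmf (R j))"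
  shows "measure_pmf.expectation (Pi_pmf I dflt R) G
    = measure_pmf.expectation (Pi_pmf (I - {i}) dflt R) (\<lambda>u. measure_pmf.expectation (R i) (\<lambda>x. G (u(i := x))))"
proof -
  let ?P = "Pi_pmf (I - {i}) dflt R"
  have fin: "finite (set_pmf ?P)"
    using assms by (intro finite_set_Pi_pmf) auto
  have "Pi_pmf I dflt R = Pi_pmf (insert i (I - {i})) dflt R"
    using assms(2) by (simp add: insert_absorb)
  also have "\<dots> = do {y \<leftarrow> R i; u \<leftarrow> ?P; return_pmf (u(i := y))}"
    using assms(1) by (intro Pi_pmf_insert') auto
  also have "\<dots> = bind_pmf ?P (\<lambda>u. map_pmf (\<lambda>y. u(i := y)) (R i))"
    by (subst bind_commute_pmf) (simp add: map_pmf_def)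
  finally have "measure_pmf.expectation (Pi_pmf I dflt R) G
      = (\<Sum>u\<in>set_pmf ?P. pmf ?P u *\<^sub>R measure_pmf.expectation (map_pmf (\<lambda>y. u(i := y)) (R i)) G)"
    using assms(2,3) fin by (simp only:) (intro pmf_expectation_bind; simp)
  also have "\<dots> = measure_pmf.expectation ?P (\<lambda>u. measure_pmf.expectation (R i) (\<lambda>x. G (u(i := x))))"
    using fin by (subst integral_measure_pmf[of "set_pmf ?P"]) auto
  finally show ?thesis .
qed

text \<open>Chernoff's method with exponent 1 / B: on [0, B] the function exp (x / B) is at most 1 +
  2 x / B, so bounds on range and mean suffice.\<close>

lemma Pi_pmf_sum_tail:
  fixes R :: "'i \<Rightarrow> real pmf"
  assumes "finite J" and R: "\<And>j. j \<in> J \<Longrightarrow> set_pmf (R j) \<subseteq> {0..B}" "\<And>j. j \<in> J \<Longrightarrow> finite (set_pmf (R j))"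
    "\<And>j. j \<in> J \<Longrightarrow> measure_pmf.expectation (R j) (\<lambda>x. x) \<le> \<mu>" and "B > 0"
  shows "measure_pmf.expectation (Pi_pmf J 0 R) (\<lambda>u. if K < sum u J then 1 else 0)
    \<le> exp ((2 * real (card J) * \<mu> - K) / B)"
proof -
  have fin: "finite (set_pmf (Pi_pmf J 0 R))"
    using assms by (intro finite_set_Pi_pmf) auto
  have "measure_pmf.expectation (Pi_pmf J 0 R) (\<lambda>u. if K < sum u J then 1 else 0)
      \<le> measure_pmf.expectation (Pi_pmf J 0 R) (\<lambda>u. exp (- K / B) * (\<Prod>j\<in>J. exp (u j / B)))"
  proof (intro integral_mono integrable_measure_pmf_finite fin)
    fix u :: "'i \<Rightarrow> real"
    have "exp (- K / B) * (\<Prod>j\<in>J. exp (u j / B)) = exp ((sum u J - K) / B)"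
      using assms(1) by (simp add: exp_sum[symmetric] sum_divide_distrib[symmetric] exp_add[symmetric] diff_divide_distrib)
    then show "(if K < sum u J then 1 else 0) \<le> exp (- K / B) * (\<Prod>j\<in>J. exp (u j / B))"
      using \<open>B > 0\<close> by simp
  qed
  also have "\<dots> = exp (- K / B) * (\<Prod>j\<in>J. measure_pmf.expectation (R j) (\<lambda>x. exp (x / B)))"
    using assms(1) R(2) by (simp, intro expectation_prod_Pi_pmf) (auto intro: integrable_measure_pmf_finite)
  also have "\<dots> \<le> exp (- K / B) * (\<Prod>j\<in>J. exp (2 * \<mu> / B))"
  proof (intro mult_left_mono prod_mono conjI)
    fix j assume j: "j \<in> J"
    show "0 \<le> measure_pmf.expectation (R j) (\<lambda>x. exp (x / B))"
      by (intro integral_nonneg_AE) auto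
    have "measure_pmf.expectation (R j) (\<lambda>x. exp (x / B)) \<le> measure_pmf.expectation (R j) (\<lambda>x. 1 + (2 / B) * x)"
    proof (intro integral_mono_AE integrable_measure_pmf_finite R(2)[OF j])
      have "exp (x / B) \<le> 1 + (2 / B) * x" if "x \<in> {0..B}" for x
      proof -
        have y: "0 \<le> x / B" "x / B \<le> 1"
          using that \<open>B > 0\<close> by auto
        then have "exp (x / B) \<le> 1 + x / B + (x / B)\<^sup>2"
          by (rule exp_bound)
        also have "(x / B)\<^sup>2 \<le> x / B"
          using mult_left_le[OF y(2) y(1)] by (simp only: power2_eq_square)
        finally show ?thesis
          by simp
      qed
      then show "AE x in R j. exp (x / B) \<le> 1 + (2 / B) * x"
        using R(1)[OF j] by (auto simp: AE_measure_pmf_iff)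
    qed
    also have "\<dots> = 1 + (2 / B) * measure_pmf.expectation (R j) (\<lambda>x. x)"
      using R(2)[OF j] by (subst Bochner_Integration.integral_add) (auto intro: integrable_measure_pmf_finite)
    also have "\<dots> \<le> 1 + 2 * \<mu> / B"
      using R(3)[OF j] \<open>B > 0\<close> by (simp add: divide_right_mono)
    also have "\<dots> \<le> exp (2 * \<mu> / B)"
      by (rule exp_ge_add_one_self)
    finally show "measure_pmf.expectation (R j) (\<lambda>x. exp (x / B)) \<le> exp (2 * \<mu> / B)" .
  qed simp
  also have "\<dots> = exp ((2 * real (card J) * \<mu> - K) / B)"
    by (simp add: exp_of_nat_mult[symmetric] exp_add[symmetric] diff_divide_distrib)
  finally show ?thesis .
qed

section \<open>Replacing the weights one at a time\<close>

text \<open>Lindeberg's hybrid argument: consecutive hybrids differ in one coordinate. Where the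
  remaining weights exceed K, the step is bounded trivially by 1 and charged to the Chernoff
  tail.\<close>

lemma Pi_pmf_replace_all:
  fixes P Q :: "real pmf" and G :: "('i \<Rightarrow> real) \<Rightarrow> real"
  assumes "finite I" and PQ: "set_pmf P \<subseteq> {0..B}" "set_pmf Q \<subseteq> {0..B}" "finite (set_pmf P)" "finite (set_pmf Q)"
    and \<mu>: "measure_pmf.expectation P (\<lambda>x. x) \<le> \<mu>" "measure_pmf.expectation Q (\<lambda>x. x) \<le> \<mu>" "0 \<le> \<mu>"
    and "0 < B" "0 \<le> \<tau>" and G: "\<And>u. 0 \<le> G u" "\<And>u. G u \<le> 1"
    and step: "\<And>i u. i \<in> I \<Longrightarrow> (\<And>j. j \<in> I - {i} \<Longrightarrow> 0 \<le> u j) \<Longrightarrow> sum u (I - {i}) \<le> K \<Longrightarrow>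
      \<bar>measure_pmf.expectation P (\<lambda>x. G (u(i := x))) - measure_pmf.expectation Q (\<lambda>x. G (u(i := x)))\<bar> \<le> \<tau>"
  shows "\<bar>measure_pmf.expectation (Pi_pmf I 0 (\<lambda>_. P)) G - measure_pmf.expectation (Pi_pmf I 0 (\<lambda>_. Q)) G\<bar>
    \<le> real (card I) * (\<tau> + exp ((2 * real (card I) * \<mu> - K) / B))"
proof -
  define R where "R J j = (if j \<in> J then Q else P)" for J and j :: 'i
  define \<eta> where "\<eta> = \<tau> + exp ((2 * real (card I) * \<mu> - K) / B)"
  define E where "E J = measure_pmf.expectation (Pi_pmf I 0 (R J)) G" for J
  have R: "set_pmf (R J j) \<subseteq> {0..B}" "finite (set_pmf (R J j))"
      "measure_pmf.expectation (R J j) (\<lambda>x. x) \<le> \<mu>" for J j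
    using PQ \<mu> by (simp_all add: R_def)
  have unit: "measure_pmf.expectation p g \<in> {0..1}"
    if "finite (set_pmf p)" "\<And>x. 0 \<le> g x" "\<And>x. g x \<le> 1" for p :: "real pmf" and g :: "real \<Rightarrow> real"
  proof -
    have "measure_pmf.expectation p g \<le> 1"
      using that by (intro measure_pmf.integral_le_const integrable_measure_pmf_finite) auto
    moreover have "0 \<le> measure_pmf.expectation p g"
      using that by (intro integral_nonneg_AE) auto
    ultimately show ?thesis
      by simp
  qed
  have one: "\<bar>E J - E (insert i J)\<bar> \<le> \<eta>" if i: "i \<in> I" "i \<notin> J" for i J
  proof -
    let ?rest = "Pi_pmf (I - {i}) 0 (R J)"
    have fin: "finite (set_pmf ?rest)"
      using assms(1) R by (intro finite_set_Pi_pmf) auto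
    have rest_eq: "Pi_pmf (I - {i}) 0 (R (insert i J)) = ?rest"
      using assms(1) by (intro Pi_pmf_cong) (auto simp: R_def)
    define p q where "p u = measure_pmf.expectation P (\<lambda>x. G (u(i := x)))"
      and "q u = measure_pmf.expectation Q (\<lambda>x. G (u(i := x)))" for u
    have "E J = measure_pmf.expectation ?rest p"
      unfolding E_def p_def using expectation_Pi_pmf_split[OF assms(1) i(1), of "R J" 0 G] R i(2)
      by (simp add: R_def)
    moreover have "E (insert i J) = measure_pmf.expectation ?rest q"
      unfolding E_def q_def using expectation_Pi_pmf_split[OF assms(1) i(1), of "R (insert i J)" 0 G] R
      by (simp add: rest_eq) (simp add: R_def)
    ultimately have "\<bar>E J - E (insert i J)\<bar> = \<bar>measure_pmf.expectation ?rest (\<lambda>u. p u - q u)\<bar>"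
      using fin by (simp add: integrable_measure_pmf_finite)
    also have "\<dots> \<le> measure_pmf.expectation ?rest (\<lambda>u. \<bar>p u - q u\<bar>)"
      by (rule integral_abs_bound)
    also have "\<dots> \<le> measure_pmf.expectation ?rest (\<lambda>u. \<tau> + (if K < sum u (I - {i}) then 1 else 0))"
    proof (intro integral_mono_AE integrable_measure_pmf_finite fin)
      have "\<bar>p u - q u\<bar> \<le> \<tau> + (if K < sum u (I - {i}) then 1 else 0)" if "u \<in> set_pmf ?rest" for u
      proof (cases "K < sum u (I - {i})")
        case True
        have "p u \<in> {0..1}" "q u \<in> {0..1}"
          unfolding p_def q_def using PQ G by (intro unit; simp)+
        then show ?thesis
          using True \<open>0 \<le> \<tau>\<close> by (auto simp: abs_le_iff)
      next
        case False
        have "0 \<le> u j" if "j \<in> I - {i}" for j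
          using \<open>u \<in> set_pmf ?rest\<close> that assms(1) R(1)[of J j] by (auto simp: set_Pi_pmf PiE_dflt_def)
        then show ?thesis
          using step[OF i(1), of u] False by (simp add: p_def q_def)
      qed
      then show "AE u in ?rest. \<bar>p u - q u\<bar> \<le> \<tau> + (if K < sum u (I - {i}) then 1 else 0)"
        by (simp add: AE_measure_pmf_iff)
    qed
    also have "\<dots> = \<tau> + measure_pmf.expectation ?rest (\<lambda>u. if K < sum u (I - {i}) then 1 else 0)"
      using fin by (subst Bochner_Integration.integral_add) (auto intro: integrable_measure_pmf_finite)
    also have "\<dots> \<le> \<tau> + exp ((2 * real (card (I - {i})) * \<mu> - K) / B)"
      using assms(1) R \<open>0 < B\<close> by (intro add_left_mono Pi_pmf_sum_tail) auto
    also have "\<dots> \<le> \<eta>"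
    proof -
      have "real (card (I - {i})) * \<mu> \<le> real (card I) * \<mu>"
        using \<mu>(3) assms(1) by (intro mult_right_mono) (auto intro: card_mono)
      then show ?thesis
        unfolding \<eta>_def using \<open>0 < B\<close> by (simp add: divide_right_mono)
    qed
    finally show ?thesis .
  qed
  have "\<bar>E {} - E J\<bar> \<le> real (card J) * \<eta>" if "finite J" "J \<subseteq> I" for J
    using that
  proof (induction J)
    case (insert i J)
    then have "\<bar>E {} - E J\<bar> \<le> real (card J) * \<eta>" "\<bar>E J - E (insert i J)\<bar> \<le> \<eta>"
      using one by auto
    then show ?case
      using insert.hyps by (simp add: distrib_right)
  qed simp
  from this[OF assms(1) order_refl] have "\<bar>E {} - E I\<bar> \<le> real (card I) * \<eta>" .
  moreover have "R {} = (\<lambda>_. P)" "Pi_pmf I 0 (R I) = Pi_pmf I 0 (\<lambda>_. Q)"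
    using assms(1) by (auto simp: R_def intro: Pi_pmf_cong)
  ultimately show ?thesis
    unfolding E_def \<eta>_def by simp
qed

lemma expectation_Pi_pmf_component:
  fixes g :: "'b \<Rightarrow> real"
  assumes "finite I" "i \<in> I"
  shows "measure_pmf.expectation (Pi_pmf I dflt R) (\<lambda>u. g (u i)) = measure_pmf.expectation (R i) g"
  using Pi_pmf_component[OF assms(1), of i dflt R] assms(2)
    integral_map_pmf[of "\<lambda>u. u i" "Pi_pmf I dflt R" g] by simp

lemma expectation_Pi_pmf_sum:
  fixes g :: "'b \<Rightarrow> real"
  assumes "finite I" "finite (set_pmf P)"
  shows "measure_pmf.expectation (Pi_pmf I dflt (\<lambda>_. P)) (\<lambda>u. \<Sum>i\<in>I. g (u i))
    = real (card I) * measure_pmf.expectation P g"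
proof -
  have "finite (set_pmf (Pi_pmf I dflt (\<lambda>_. P)))"
    using assms by (intro finite_set_Pi_pmf)
  then show ?thesis
    using assms(1) by (subst Bochner_Integration.integral_sum)
      (auto intro!: integrable_measure_pmf_finite simp: expectation_Pi_pmf_component)
qed

text \<open>The labels themselves serve as target values, since \<open>sign_pm\<close> fixes -1 and
  1.\<close>

lemma interpolable_agrees:
  assumes "interpolable n W" "W \<subseteq> cube n" "\<And>x. x \<in> cube n \<Longrightarrow> f x \<in> {-1, 1}"
  shows "\<exists>h\<in>halfspaces n. \<forall>x\<in>W. f x = h x"
proof -
  obtain w where w: "\<forall>x\<in>W. aff_form n w x = f x"
    using assms(1) unfolding interpolable_def by blast
  have "f x = (\<lambda>x\<in>cube n. sign_pm (aff_form n w x)) x" if "x \<in> W" for x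
  proof -
    have "x \<in> cube n" "f x \<in> {-1, 1}"
      using that assms by auto
    then show ?thesis
      using w that by (auto simp: sign_pm_def)
  qed
  then show ?thesis
    unfolding halfspaces_eq by blast
qed

lemma halfspaces_nonempty: "halfspaces n \<noteq> {}"
  unfolding halfspaces_eq by blast

text \<open>
  A guarantee given by both kinds of testers: for sample testers \<open>f\<close> may be replaced by \<open>h\<close>, and for
  query testers the distance is zero.
\<close>

definition distinguishes :: "nat \<Rightarrow> real \<Rightarrow> (nat \<Rightarrow> real) query_tester \<Rightarrow> bool" where
  "distinguishes n \<epsilon> t \<longleftrightarrow> (\<forall>D f. set_pmf D \<subseteq> cube n \<longrightarrow> f \<in> cube n \<rightarrow>\<^sub>E {-1, 1} \<longrightarrow>
     ((\<exists>h\<in>halfspaces n. \<forall>x\<in>set_pmf D. f x = h x) \<longrightarrow> pmf (run_query_tester t D f) True \<ge> 2/3) \<and>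
     (dist_class D f (halfspaces n) \<ge> \<epsilon> \<longrightarrow> pmf (run_query_tester t D f) False \<ge> 2/3))"

text \<open>For small q the mean acceptance probabilities under U and V would differ by at most 1/4,
  whereas correctness keeps them nearly 1/3 apart.\<close>

lemma distinguishes_cost_bound:
  fixes a :: real and N :: real
  assumes cost: "cost_at_most (cube n) q t" and dis: "distinguishes n \<epsilon> t" and eps: "\<epsilon> \<le> 1 / 6400"
    and S: "S \<subseteq> cube n" "card S = 64 * n" and n: "1 \<le> n" and k: "n \<le> 32 * k"
    and interp: "\<And>W. W \<subseteq> S \<Longrightarrow> card W \<le> k \<Longrightarrow> interpolable n W"
    and f: "f \<in> cube n \<rightarrow>\<^sub>E {-1, 1}" "\<And>h. h \<in> halfspaces n \<Longrightarrow> 4 * n < card {x \<in> S. f x \<noteq> h x}"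
    and a_def: "a = 1 / 4000000" and N_def: "N = 64 * real n - 1" and "1 \<le> r"
    and tail: "N * exp (1 - 180 * a * N / (real r)\<^sup>2) \<le> 1 / 8" and r: "8 * N \<le> 4 ^ r"
  shows "6 * a * N / r < real q"
proof (rule ccontr)
  assume "\<not> 6 * a * N / r < real q"
  then have q: "real q \<le> 6 * a * N / r"
    by simp
  have finS: "finite S"
    using S(1) finite_subset by (metis finite_cube)
  have "S \<noteq> {}"
    using S(2) n by auto
  then obtain d where d: "d \<in> S"
    by blast
  define I where "I = S - {d}"
  have I: "finite I" "d \<notin> I" "I \<subseteq> cube n" "insert d I = S"
    using finS S(1) d by (auto simp: I_def)
  have N: "real (card I) = N"
    using S(2) d finS n by (simp add: I_def N_def of_nat_diff)
  have N_pos: "63 * real n \<le> N" "N \<le> 64 * real n" "0 < N"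
    using n by (simp_all add: N_def)
  have "a > 0"
    by (simp add: a_def)
  \<comment> \<open>With \<delta> = 4 a, the main atom of V is at a, the exceptional mass is 5
    \<delta> = 20 a, and the range is at most r^2.\<close>
  obtain U V :: "real pmf" where
    UV: "set_pmf U \<subseteq> {0..(real r)\<^sup>2}" "set_pmf V \<subseteq> {0..(real r)\<^sup>2}" "finite (set_pmf U)" "finite (set_pmf V)"
    and mom: "\<And>k. k \<le> r \<Longrightarrow> measure_pmf.expectation U (\<lambda>x. x ^ k) = measure_pmf.expectation V (\<lambda>x. x ^ k)"
    and U0: "measure_pmf.expectation U (\<lambda>x. if x \<noteq> 0 then 1 else 0) \<le> 20 * a"
    and Va: "measure_pmf.expectation V (\<lambda>x. if x \<noteq> a then 1 else 0) \<le> 20 * a"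
    and Vm: "measure_pmf.expectation V (\<lambda>x. x) \<le> 10 * a"
    using matching_pmfs[of "4 * a" r] \<open>1 \<le> r\<close> by (auto simp: a_def)
  have Um: "measure_pmf.expectation U (\<lambda>x. x) \<le> 10 * a"
    using mom[of 1] Vm \<open>1 \<le> r\<close> by simp
  \<comment> \<open>Twenty times the bound 10 a N on the expected total: Markov's inequality then
    costs only 1/20, while an atom a still has share 1 / (200 N).\<close>
  define M where "M = 200 * a * N"
  define B where "B = (real r)\<^sup>2"
  have "M > 0" "B > 0"
    using \<open>a > 0\<close> N_pos(3) \<open>1 \<le> r\<close> by (simp_all add: M_def B_def)
  define G where "G = spread_accept t f M d I"
  define \<tau> where "\<tau> = (\<Sum>j\<in>{r<..q}. real (q choose j) * (2 * B / M) ^ j)"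
  have f': "f x \<in> {-1, 1}" if "x \<in> cube n" for x
    using f(1) that by (rule PiE_mem)
  have diff: "\<bar>measure_pmf.expectation (Pi_pmf I 0 (\<lambda>_. U)) G - measure_pmf.expectation (Pi_pmf I 0 (\<lambda>_. V)) G\<bar>
      \<le> real (card I) * (\<tau> + exp ((2 * real (card I) * (10 * a) - (M - B)) / B))"
  proof (rule Pi_pmf_replace_all)
    show "0 \<le> \<tau>"
      unfolding \<tau>_def using \<open>B > 0\<close> \<open>M > 0\<close> by (intro sum_nonneg) auto
    show "\<bar>measure_pmf.expectation U (\<lambda>x. G (u(i := x))) - measure_pmf.expectation V (\<lambda>x. G (u(i := x)))\<bar> \<le> \<tau>"
      if "i \<in> I" "\<And>j. j \<in> I - {i} \<Longrightarrow> 0 \<le> u j" "sum u (I - {i}) \<le> M - B" for i u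
      unfolding G_def \<tau>_def
      using spread_accept_replace_one[where f = f and P = U and Q = V and u = u and B = B and M = M and r = r,
          OF cost finite_cube I(3) _ I(2) that(1) f' \<open>M > 0\<close> _ _ UV(3,4) mom that(2,3)]
      using UV(1,2) d S(1) \<open>B > 0\<close> by (auto simp: B_def)
  qed (use I UV Um Vm \<open>a > 0\<close> \<open>B > 0\<close> spread_accept_bounds in \<open>auto simp: B_def G_def\<close>)
  \<comment> \<open>Tilting by 16 leaves 16^r on the left and e^r, hence 4^r, on the right. So
    \<tau> is at most 4^(-r), which is at most 1 / (8 N).\<close>
  have \<tau>_le: "N * \<tau> \<le> 1 / 8"
  proof -
    have y: "0 \<le> 2 * B / M"
      using \<open>B > 0\<close> \<open>M > 0\<close> by simp
    have "\<tau> * 16 ^ r \<le> (1 + 2 * B / M * 16) ^ q"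
      unfolding \<tau>_def using y by (intro sum_binomial_tail_le) auto
    also have "\<dots> \<le> exp (2 * B / M * 16) ^ q"
      using y by (intro power_mono) (auto intro: add_nonneg_nonneg)
    also have "\<dots> = exp (real q * (2 * B / M * 16))"
      by (rule exp_of_nat_mult[symmetric])
    also have "\<dots> \<le> exp (real r)"
    proof -
      have "real q * (2 * B / M * 16) \<le> 6 * a * N / r * (2 * B / M * 16)"
        using q y by (intro mult_right_mono) auto
      also have "\<dots> = 24 / 25 * real r"
        using \<open>a > 0\<close> N_pos(3) \<open>1 \<le> r\<close> by (simp add: M_def B_def field_simps power2_eq_square)
      finally show ?thesis
        by simp
    qed
    also have "\<dots> = exp 1 ^ r"
      using exp_of_nat_mult[of r "1::real"] by simp
    also have "\<dots> \<le> 4 ^ r"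
      using exp_le by (intro power_mono) auto
    finally have "\<tau> * 4 ^ r * 4 ^ r \<le> 4 ^ r"
      by (simp add: power_mult_distrib[symmetric] mult.assoc)
    then have \<tau>4: "\<tau> * 4 ^ r \<le> 1"
      by simp
    have "8 * N * \<tau> \<le> 4 ^ r * \<tau>"
      using r \<open>B > 0\<close> \<open>M > 0\<close> by (intro mult_right_mono) (auto simp: \<tau>_def intro!: sum_nonneg)
    then show ?thesis
      using \<tau>4 by (simp add: mult_ac)
  qed
  have "(2 * N * (10 * a) - (M - B)) / B = 1 - 180 * a * N / (real r)\<^sup>2"
    using \<open>B > 0\<close> by (simp add: M_def B_def[symmetric] field_simps)
  then have close: "\<bar>measure_pmf.expectation (Pi_pmf I 0 (\<lambda>_. U)) G - measure_pmf.expectation (Pi_pmf I 0 (\<lambda>_. V)) G\<bar> \<le> 1 / 4"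
    using diff tail \<tau>_le unfolding N by (simp add: distrib_left)
  have finU: "finite (set_pmf (Pi_pmf I 0 (\<lambda>_. U)))" and finV: "finite (set_pmf (Pi_pmf I 0 (\<lambda>_. V)))"
    using I(1) UV by (auto intro: finite_set_Pi_pmf)
  have k_pos: "0 < real k"
    using k n by (cases k) auto
  have sum_ind: "(\<Sum>i\<in>I. if u i \<noteq> z then 1 else 0) = real (card {i \<in> I. u i \<noteq> z})" for u :: "(nat \<Rightarrow> real) \<Rightarrow> real" and z
    using I(1) by (simp add: sum.If_cases Int_def)
  have nonneg: "0 \<le> u i" if "u \<in> set_pmf (Pi_pmf I 0 (\<lambda>_. R))" "set_pmf R \<subseteq> {0..(real r)\<^sup>2}" "i \<in> I" for u i R
    using that I(1) by (auto simp: set_Pi_pmf PiE_dflt_def)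
  have valid: "set_pmf (spread M d I u) \<subseteq> cube n" "set_pmf (spread M d I u) \<subseteq> insert d {z \<in> I. u z \<noteq> 0}"
    if "\<And>i. i \<in> I \<Longrightarrow> 0 \<le> u i" "sum u I \<le> M" for u
    using set_spread[OF I(1,2) \<open>M > 0\<close> that] I(3,4) S(1) by auto
  \<comment> \<open>Markov's inequality is built into the following two pointwise bounds.\<close>
  have yes: "2 / 3 - (2 / 3 / M) * (\<Sum>i\<in>I. u i) - (2 / 3 / k) * (\<Sum>i\<in>I. if u i \<noteq> 0 then 1 else 0) \<le> G u"
    if u: "\<And>i. i \<in> I \<Longrightarrow> 0 \<le> u i" for u
  proof -
    have nn: "0 \<le> (2 / 3 / M) * (\<Sum>i\<in>I. u i)" "0 \<le> (2 / 3 / k) * (\<Sum>i\<in>I. if u i \<noteq> 0 then 1 else 0)"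
      using u \<open>M > 0\<close> k_pos by (intro mult_nonneg_nonneg sum_nonneg; simp)+
    show ?thesis
    proof (cases "sum u I \<le> M \<and> card {i \<in> I. u i \<noteq> 0} < k")
      case True
      let ?W = "insert d {z \<in> I. u z \<noteq> 0}"
      have "card ?W \<le> k" "?W \<subseteq> S"
        using True I by (auto simp: card_insert_if)
      then have "\<exists>h\<in>halfspaces n. \<forall>x\<in>?W. f x = h x"
        using interp S(1) f' by (intro interpolable_agrees) blast+
      then have "\<exists>h\<in>halfspaces n. \<forall>x\<in>set_pmf (spread M d I u). f x = h x"
        using valid(2)[where u = u, OF u] True by blast
      then have "2 / 3 \<le> G u"
        using dis f(1) valid(1)[where u = u, OF u] True unfolding distinguishes_def G_def spread_accept_def by simp
      with nn show ?thesis
        by linarith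
    next
      case False
      from False have "2 / 3 \<le> (2 / 3 / M) * (\<Sum>i\<in>I. u i) \<or> 2 / 3 \<le> (2 / 3 / k) * (\<Sum>i\<in>I. if u i \<noteq> 0 then 1 else 0)"
      proof (cases "sum u I \<le> M")
        case True
        then have "real k \<le> real (card {i \<in> I. u i \<noteq> 0})"
          using False by simp
        then show ?thesis
          using k_pos unfolding sum_ind by (simp add: field_simps)
      next
        case False
        then show ?thesis
          using \<open>M > 0\<close> by (simp add: field_simps)
      qed
      then show ?thesis
        using nn spread_accept_bounds(1)[of t f M d I u] unfolding G_def by linarith
    qed
  qed
  have no: "G u \<le> 1 / 3 + (1 / (2 * real n)) * (\<Sum>i\<in>I. if u i \<noteq> a then 1 else 0)"
    if u: "\<And>i. i \<in> I \<Longrightarrow> 0 \<le> u i" for u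
  proof (cases "card {i \<in> I. u i \<noteq> a} < 2 * n \<and> sum u I \<le> M")
    case True
    have "1 / 6400 \<le> dist_class (spread M d I u) f (halfspaces n)"
      unfolding dist_class_def
    proof (rule cINF_greatest[OF halfspaces_nonempty])
      fix h assume h: "h \<in> halfspaces n"
      let ?E = "{x \<in> S. f x \<noteq> h x}" and ?A = "{i \<in> I. u i \<noteq> a}"
      define X where "X = ?E - {d} - ?A"
      have X: "X \<subseteq> I" "finite X" "\<And>x. x \<in> X \<Longrightarrow> u x = a" "X \<subseteq> {x. f x \<noteq> h x}"
        using finS by (auto simp: X_def I_def)
      have "card ?E \<le> card (X \<union> ({d} \<union> ?A))"
      proof (rule card_mono)
        show "finite (X \<union> ({d} \<union> ?A))"
          using X(2) I(1) by simp
        show "?E \<subseteq> X \<union> ({d} \<union> ?A)"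
          unfolding X_def I_def by blast
      qed
      also have "\<dots> \<le> card X + (card {d} + card ?A)"
        by (rule order_trans[OF card_Un_le add_left_mono[OF card_Un_le]])
      \<comment> \<open>Of more than 4n disagreements, at most one is lost to \<open>d\<close> and
        fewer than 2n to points whose weight is not a.\<close>
      finally have "2 * n \<le> card X"
        using f(2)[OF h] True by simp
      then have "a / M * (2 * real n) \<le> a / M * real (card X)"
        using \<open>a > 0\<close> \<open>M > 0\<close> by (intro mult_left_mono) auto
      also have "\<dots> = (\<Sum>x\<in>X. pmf (spread M d I u) x)"
        using X I(2) True u by (simp add: pmf_spread[OF I(1,2) \<open>M > 0\<close>] subset_iff)
      also have "\<dots> = measure_pmf.prob (spread M d I u) X"
        using X(2) by (rule measure_measure_pmf_finite[symmetric])
      also have "\<dots> \<le> dist_fun (spread M d I u) f h"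
        unfolding dist_fun_def using X(4) by (intro measure_pmf.finite_measure_mono) auto
      finally have "a / M * (2 * real n) \<le> dist_fun (spread M d I u) f h" .
      \<comment> \<open>The mass is 2 n a / M = n / (100 N) with N at most 64 n; this is the origin
        of the threshold for \<epsilon>.\<close>
      moreover have "1 / 6400 \<le> a / M * (2 * real n)"
        using \<open>a > 0\<close> N_pos by (simp add: M_def field_simps)
      ultimately show "1 / 6400 \<le> dist_fun (spread M d I u) f h"
        by linarith
    qed
    then have "\<epsilon> \<le> dist_class (spread M d I u) f (halfspaces n)"
      using eps by linarith
    then have "2 / 3 \<le> pmf (run_query_tester t (spread M d I u) f) False"
      using dis f(1) valid(1)[where u = u, OF u] True unfolding distinguishes_def by simp
    then have "G u \<le> 1 / 3"
      using True by (simp add: G_def spread_accept_def pmf_False_conv_True)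
    moreover have "0 \<le> (1 / (2 * real n)) * (\<Sum>i\<in>I. if u i \<noteq> a then 1 else 0)"
      by (intro mult_nonneg_nonneg sum_nonneg) auto
    ultimately show ?thesis
      by linarith
  next
    case False
    show ?thesis
    proof (cases "sum u I \<le> M")
      case True
      then have "2 * real n \<le> real (card {i \<in> I. u i \<noteq> a})"
        using False by linarith
      then have "1 \<le> (1 / (2 * real n)) * (\<Sum>i\<in>I. if u i \<noteq> a then 1 else 0)"
        unfolding sum_ind using n by (simp add: field_simps)
      then show ?thesis
        using spread_accept_bounds(2)[of t f M d I u] unfolding G_def by linarith
    next
      case False
      have "0 \<le> (1 / (2 * real n)) * (\<Sum>i\<in>I. if u i \<noteq> a then 1 else 0)"
        by (intro mult_nonneg_nonneg sum_nonneg) auto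
      then show ?thesis
        using False by (simp add: G_def spread_accept_def)
    qed
  qed
  have "2 / 3 - (2 / 3 / M) * (N * (10 * a)) - (2 / 3 / k) * (N * (20 * a))
      \<le> 2 / 3 - (2 / 3 / M) * (N * measure_pmf.expectation U (\<lambda>x. x))
        - (2 / 3 / k) * (N * measure_pmf.expectation U (\<lambda>x. if x \<noteq> 0 then 1 else 0))"
    using Um U0 \<open>M > 0\<close> k_pos N_pos(3) by (intro diff_mono mult_left_mono) auto
  also have "\<dots> = measure_pmf.expectation (Pi_pmf I 0 (\<lambda>_. U)) (\<lambda>u. 2 / 3 - (2 / 3 / M) * (\<Sum>i\<in>I. u i)
      - (2 / 3 / k) * (\<Sum>i\<in>I. if u i \<noteq> 0 then 1 else 0))"
    using expectation_Pi_pmf_sum[OF I(1) UV(3), of 0 "\<lambda>x. x"]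
      expectation_Pi_pmf_sum[OF I(1) UV(3), of 0 "\<lambda>x. if x \<noteq> 0 then 1 else 0"]
    by (simp add: integrable_measure_pmf_finite[OF finU] N)
  also have "\<dots> \<le> measure_pmf.expectation (Pi_pmf I 0 (\<lambda>_. U)) G"
    using yes nonneg[OF _ UV(1)]
    by (intro integral_mono_AE integrable_measure_pmf_finite finU) (auto simp: AE_measure_pmf_iff)
  finally have low: "2 / 3 - (2 / 3 / M) * (N * (10 * a)) - (2 / 3 / k) * (N * (20 * a))
      \<le> measure_pmf.expectation (Pi_pmf I 0 (\<lambda>_. U)) G" .
  have "measure_pmf.expectation (Pi_pmf I 0 (\<lambda>_. V)) G
      \<le> measure_pmf.expectation (Pi_pmf I 0 (\<lambda>_. V)) (\<lambda>u. 1 / 3 + (1 / (2 * real n)) * (\<Sum>i\<in>I. if u i \<noteq> a then 1 else 0))"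
    using no nonneg[OF _ UV(2)]
    by (intro integral_mono_AE integrable_measure_pmf_finite finV) (auto simp: AE_measure_pmf_iff)
  also have "\<dots> = 1 / 3 + (1 / (2 * real n)) * (N * measure_pmf.expectation V (\<lambda>x. if x \<noteq> a then 1 else 0))"
    using expectation_Pi_pmf_sum[OF I(1) UV(4), of 0 "\<lambda>x. if x \<noteq> a then 1 else 0"]
    by (simp add: integrable_measure_pmf_finite[OF finV] N)
  also have "\<dots> \<le> 1 / 3 + (1 / (2 * real n)) * (N * (20 * a))"
    using Va n N_pos(3) by (intro add_left_mono mult_left_mono) auto
  finally have high: "measure_pmf.expectation (Pi_pmf I 0 (\<lambda>_. V)) G \<le> 1 / 3 + (1 / (2 * real n)) * (N * (20 * a))" .
  \<comment> \<open>Losses of 1/30, 1/100 and 1/100 leave 7/25 of the gap 1/3, more than the 1/4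
    allowed by \<open>close\<close>.\<close>
  have "(2 / 3 / M) * (N * (10 * a)) = 1 / 30"
    using \<open>a > 0\<close> N_pos(3) by (simp add: M_def)
  moreover have "(2 / 3 / k) * (N * (20 * a)) \<le> 1 / 100"
  proof -
    have "N \<le> 2048 * real k"
      using N_pos k by linarith
    then show ?thesis
      using k_pos by (simp add: a_def field_simps)
  qed
  moreover have "(1 / (2 * real n)) * (N * (20 * a)) \<le> 1 / 100"
    using N_pos n by (simp add: a_def field_simps)
  ultimately show False
    using low high close by linarith
qed

section \<open>The lower bound\<close>

text \<open>A tree of cost 0 consists of tosses and verdicts only.\<close>

lemma run_query_tester_free:
  "cost_at_most X q t \<Longrightarrow> q = 0 \<Longrightarrow> run_query_tester t D f = run_query_tester t D' f'"
proof (induction rule: cost_at_most.induct)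
  case (4 p q)
  then show ?case
    by (simp add: bind_map_pmf cong: bind_pmf_cong_simp)
qed simp_all

lemma dist_class_eq_0:
  assumes "h \<in> H" "\<And>x. x \<in> set_pmf D \<Longrightarrow> f x = h x"
  shows "dist_class D f H = 0"
proof (rule antisym)
  have "dist_fun D f h = 0"
    using assms(2) by (auto simp: dist_fun_def measure_pmf_zero_iff)
  moreover have "dist_class D f H \<le> dist_fun D f h"
    unfolding dist_class_def using assms(1)
    by (intro cINF_lower bdd_belowI2[of _ 0]) (auto simp: dist_fun_def)
  ultimately show "dist_class D f H \<le> 0"
    by simp
  show "0 \<le> dist_class D f H"
    unfolding dist_class_def using assms(1) by (intro cINF_greatest) (auto simp: dist_fun_def)
qed

lemma distinguishes_query_tester:
  assumes "is_query_tester (cube n) (halfspaces n) \<epsilon> t"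
  shows "distinguishes n \<epsilon> t"
  unfolding distinguishes_def
proof (intro allI impI conjI)
  fix D and f :: "(nat \<Rightarrow> real) \<Rightarrow> real"
  assume D: "set_pmf D \<subseteq> cube n" and f: "f \<in> cube n \<rightarrow>\<^sub>E {-1, 1}"
  note t = assms[unfolded is_query_tester_def, rule_format, OF D f]
  show "2 / 3 \<le> pmf (run_query_tester t D f) True" if "\<exists>h\<in>halfspaces n. \<forall>x\<in>set_pmf D. f x = h x"
  proof -
    from that obtain h where h: "h \<in> halfspaces n" "\<forall>x\<in>set_pmf D. f x = h x"
      by blast
    then have "dist_class D f (halfspaces n) = 0"
      by (intro dist_class_eq_0[of h]) simp_all
    then show ?thesis
      using t by blast
  qed
  show "2 / 3 \<le> pmf (run_query_tester t D f) False" if "\<epsilon> \<le> dist_class D f (halfspaces n)"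
    using t that by blast
qed

lemma halfspaces_subset: "halfspaces n \<subseteq> cube n \<rightarrow>\<^sub>E {-1, 1}"
proof
  fix h assume h: "h \<in> halfspaces n"
  then show "h \<in> cube n \<rightarrow>\<^sub>E {-1, 1}"
    using halfspaces_values[OF h] by (auto simp: halfspaces_eq)
qed

lemma run_sample_tester_cong:
  assumes "\<And>x. x \<in> set_pmf D \<Longrightarrow> f x = g x"
  shows "run_sample_tester m T D f = run_sample_tester m T D g"
  unfolding run_sample_tester_def
proof (rule bind_pmf_cong[OF refl])
  fix xs assume "xs \<in> set_pmf (replicate_pmf m D)"
  then have "map (\<lambda>x. (x, f x)) xs = map (\<lambda>x. (x, g x)) xs"
    using assms by (auto simp: set_replicate_pmf)
  then show "T (map (\<lambda>x. (x, f x)) xs) = T (map (\<lambda>x. (x, g x)) xs)"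
    by (rule arg_cong)
qed

text \<open>A sample tester sees labels on the support of D only, so a function agreeing there with
  a halfspace is treated like that halfspace.\<close>

lemma distinguishes_sample_tree:
  assumes "is_sample_tester (cube n) (halfspaces n) \<epsilon> m T"
  shows "distinguishes n \<epsilon> (sample_tree T m [])"
proof -
  have run: "run_query_tester (sample_tree T m []) D f = run_sample_tester m T D f" for D f
    by (simp add: run_sample_tree run_sample_tester_def)
  show ?thesis
    unfolding distinguishes_def run
  proof (intro allI impI conjI)
    fix D and f :: "(nat \<Rightarrow> real) \<Rightarrow> real"
    assume D: "set_pmf D \<subseteq> cube n" and f: "f \<in> cube n \<rightarrow>\<^sub>E {-1, 1}"
    note T = assms[unfolded is_sample_tester_def, rule_format, OF D]
    show "2 / 3 \<le> pmf (run_sample_tester m T D f) True" if "\<exists>h\<in>halfspaces n. \<forall>x\<in>set_pmf D. f x = h x"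
    proof -
      from that obtain h where h: "h \<in> halfspaces n" "\<forall>x\<in>set_pmf D. f x = h x"
        by blast
      then have "run_sample_tester m T D f = run_sample_tester m T D h"
        by (intro run_sample_tester_cong) simp
      moreover have "h \<in> cube n \<rightarrow>\<^sub>E {-1, 1}"
        using h(1) halfspaces_subset by blast
      ultimately show ?thesis
        using T[of h] h(1) by simp
    qed
    show "2 / 3 \<le> pmf (run_sample_tester m T D f) False" if "\<epsilon> \<le> dist_class D f (halfspaces n)"
      using T[OF f] that by blast
  qed
qed

lemma constant_in_halfspaces: "(\<lambda>x\<in>cube n. 1) \<in> halfspaces n"
  unfolding halfspaces_eq by (auto simp: aff_form_def sign_pm_def intro!: exI[of _ "\<lambda>_. 0"])

text \<open>This serves the finitely many small n. The product of two coordinates is at distance at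
  least 1/4 from halfspaces under the uniform distribution on four points, and without queries or
  samples it looks like a constant.\<close>

lemma distinguishes_cost_pos:
  assumes "cost_at_most (cube n) q t" "distinguishes n \<epsilon> t" "2 \<le> n" "\<epsilon> \<le> 1 / 4"
  shows "1 \<le> q"
proof (rule ccontr)
  assume "\<not> 1 \<le> q"
  then have "q = 0"
    by simp
  define p where "p a b = (\<lambda>i\<in>{1..n}. if i = 1 then a else if i = 2 then b else 1)" for a b :: real
  define S where "S = {p 1 1, p 1 (-1), p (-1) 1, p (-1) (-1)}"
  define f where "f = (\<lambda>x\<in>cube n. x 1 * x 2)"
  have p_val: "p a b 1 = a" "p a b 2 = b" for a b
    using assms(3) by (simp_all add: p_def)
  have p_eq: "p a b = p a' b' \<longleftrightarrow> a = a' \<and> b = b'" for a b a' b'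
    using p_val by metis
  have card_S: "card S = 4"
    unfolding S_def by (simp add: p_eq)
  have p_cube: "p a b \<in> cube n" if "a \<in> {-1, 1}" "b \<in> {-1, 1}" for a b
    using that by (auto simp: p_def cube_def)
  have S: "finite S" "S \<noteq> {}" "S \<subseteq> cube n"
    using p_cube by (auto simp: S_def)
  have f: "f \<in> cube n \<rightarrow>\<^sub>E {-1, 1}"
  proof -
    have "x 1 * x 2 \<in> {-1, 1}" if "x \<in> cube n" for x
    proof -
      have "x 1 \<in> {-1, 1}" "x 2 \<in> {-1, 1}"
        using that assms(3) by (auto simp: cube_def PiE_iff)
      then show ?thesis
        by auto
    qed
    then show ?thesis
      by (simp add: f_def)
  qed
  have f_p: "f (p a b) = a * b" if "a \<in> {-1, 1}" "b \<in> {-1, 1}" for a b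
    using p_cube[OF that] p_val by (simp add: f_def)
  define D where "D = pmf_of_set S"
  have set_D: "set_pmf D = S"
    using S by (simp add: D_def)
  have "1 / 4 \<le> dist_class D f (halfspaces n)"
    unfolding dist_class_def
  proof (rule cINF_greatest[OF halfspaces_nonempty])
    fix h assume "h \<in> halfspaces n"
    then obtain w where w: "h = (\<lambda>x\<in>cube n. sign_pm (aff_form n w x))"
      unfolding halfspaces_eq by blast
    have "\<exists>x\<in>S. f x \<noteq> h x"
    proof (rule ccontr)
      assume "\<not> (\<exists>x\<in>S. f x \<noteq> h x)"
      then have h_eq: "\<forall>x\<in>S. h x = f x"
        by simp
      have "sign_pm (aff_form n w (p a b)) = a * b" if ab: "a \<in> {-1, 1}" "b \<in> {-1, 1}" for a b
      proof -
        have "p a b \<in> S"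
          using ab by (auto simp: S_def)
        then have "h (p a b) = a * b"
          using h_eq f_p[OF ab] by simp
        moreover have "h (p a b) = sign_pm (aff_form n w (p a b))"
          unfolding w by (rule restrict_apply'[OF p_cube[OF ab]])
        ultimately show ?thesis
          by (rule trans[OF sym, rotated])
      qed
      from this[of 1 1] this[of "-1" "-1"] this[of 1 "-1"] this[of "-1" 1]
      have "0 \<le> aff_form n w (p 1 1)" "0 \<le> aff_form n w (p (-1) (-1))"
        "aff_form n w (p 1 (-1)) < 0" "aff_form n w (p (-1) 1) < 0"
        by (auto simp: sign_pm_def split: if_splits)
      \<comment> \<open>The two diagonals of the square of points have the same midpoint, which
        contradicts the sign pattern of the product.\<close>
      moreover have "aff_form n w (p 1 1) + aff_form n w (p (-1) (-1))
          = aff_form n w (p 1 (-1)) + aff_form n w (p (-1) 1)"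
      proof -
        have "(\<Sum>i=1..n. w i * p 1 1 i) + (\<Sum>i=1..n. w i * p (-1) (-1) i)
            = (\<Sum>i=1..n. w i * p 1 (-1) i) + (\<Sum>i=1..n. w i * p (-1) 1 i)"
          unfolding sum.distrib[symmetric] by (intro sum.cong refl) (simp add: p_def)
        then show ?thesis
          by (simp add: aff_form_def)
      qed
      ultimately show False
        by linarith
    qed
    then obtain x where x: "x \<in> S" "f x \<noteq> h x"
      by blast
    have "1 / 4 = measure_pmf.prob D {x}"
      using x(1) S by (simp add: D_def measure_pmf_single card_S)
    also have "\<dots> \<le> dist_fun D f h"
      unfolding dist_fun_def using x(2) by (intro measure_pmf.finite_measure_mono) auto
    finally show "1 / 4 \<le> dist_fun D f h" .
  qed
  then have "2 / 3 \<le> pmf (run_query_tester t D f) False"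
    using assms(2,4) f S(3) unfolding distinguishes_def set_D[symmetric] by force
  moreover have "2 / 3 \<le> pmf (run_query_tester t D (\<lambda>x\<in>cube n. 1)) True"
    using assms(2) constant_in_halfspaces[of n] halfspaces_subset[of n] S(3)
    unfolding distinguishes_def set_D[symmetric] by blast
  moreover have "run_query_tester t D f = run_query_tester t D (\<lambda>x\<in>cube n. 1)"
    using assms(1) \<open>q = 0\<close> by (rule run_query_tester_free)
  ultimately show False
    by (simp add: pmf_False_conv_True)
qed

section \<open>Numerical estimates and choice of parameters\<close>

lemma exp_le_two_powr:
  fixes x :: real
  assumes "0 \<le> x"
  shows "exp x \<le> 2 powr (2 * x)"
proof -
  from assms have "x * (1 / 2) \<le> x * ln 2"
    using ln2_ge_two_thirds by (intro mult_left_mono) auto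
  then show ?thesis
    by (simp add: powr_def)
qed

lemma sum_binomial_le_powr:
  "(\<Sum>j\<le>d. real (N choose j)) \<le> 2 powr (real e * real d + 2 * real N / 2 ^ e)"
proof -
  have "(\<Sum>j\<le>d. real (N choose j)) \<le> (2 ^ e) ^ d * exp (real N / 2 ^ e)"
    by (intro sum_binomial_le_exp) simp
  also have "\<dots> \<le> (2 ^ e) ^ d * 2 powr (2 * (real N / 2 ^ e))"
    by (intro mult_left_mono exp_le_two_powr) auto
  also have "(2 ^ e) ^ d = (2 :: real) powr (real e * real d)"
    by (simp add: powr_realpow[symmetric] powr_powr)
  finally show ?thesis
    by (simp add: powr_add)
qed

text \<open>With e = 9 the exponent is 10 k + n / 4, at most 7 n / 8 for k at most n / 16.\<close>

lemma general_position_bound: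
  assumes "1 \<le> n"
  shows "(\<Sum>j\<le>n div 16. 64 * n choose j) * 2 ^ (n div 16) < (2 :: nat) ^ n"
proof -
  define k where "k = n div 16"
  have "16 * k \<le> n"
    unfolding k_def by simp
  then have "real k \<le> real n / 16"
    by linarith
  have "real ((\<Sum>j\<le>k. 64 * n choose j) * 2 ^ k) = (\<Sum>j\<le>k. real (64 * n choose j)) * 2 powr real k"
    by (simp add: powr_realpow)
  also have "\<dots> \<le> 2 powr (real 9 * real k + 2 * real (64 * n) / 2 ^ 9) * 2 powr real k"
    by (intro mult_right_mono sum_binomial_le_powr) simp
  also have "\<dots> = 2 powr (10 * real k + real n / 4)"
    by (simp add: powr_add[symmetric])
  also have "\<dots> < 2 powr real n"
    using \<open>real k \<le> real n / 16\<close> assms by (intro powr_less_mono) auto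
  also have "\<dots> = real (2 ^ n)"
    by (simp add: powr_realpow)
  finally show ?thesis
    unfolding k_def of_nat_less_iff .
qed

text \<open>With e = 6 for the traces and e = 4 for the balls, the exponents 8 n + 6 and 24 n add up
  to less than 64 n.\<close>

lemma far_function_bound:
  assumes "1 \<le> n"
  shows "(\<Sum>j\<le>n+1. 64 * n choose j) * (\<Sum>j\<le>4*n. 64 * n choose j) < (2 :: nat) ^ (64 * n)"
proof -
  have "real ((\<Sum>j\<le>n+1. 64 * n choose j) * (\<Sum>j\<le>4*n. 64 * n choose j))
      = (\<Sum>j\<le>n+1. real (64 * n choose j)) * (\<Sum>j\<le>4*n. real (64 * n choose j))"
    by simp
  also have "\<dots> \<le> 2 powr (real 6 * real (n + 1) + 2 * real (64 * n) / 2 ^ 6)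
      * 2 powr (real 4 * real (4 * n) + 2 * real (64 * n) / 2 ^ 4)"
    by (intro mult_mono sum_binomial_le_powr sum_nonneg) auto
  also have "\<dots> = 2 powr (32 * real n + 6)"
    by (simp add: powr_add[symmetric] algebra_simps)
  also have "\<dots> < 2 powr real (64 * n)"
    using assms by (intro powr_less_mono) auto
  also have "\<dots> = real (2 ^ (64 * n))"
    using powr_realpow[of 2 "64 * n"] by simp
  finally show ?thesis
    unfolding of_nat_less_iff .
qed

lemma distinguishes_cost_large:
  fixes a :: real
  assumes "a = 1 / 4000000"
  shows "\<exists>n0\<ge>16. \<forall>n\<ge>n0. \<forall>q t \<epsilon>. cost_at_most (cube n) q t \<longrightarrow> distinguishes n \<epsilon> t \<longrightarrow> \<epsilon> \<le> 1 / 6400 \<longrightarrow>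
    a * (real n / ln (real n)) \<le> real q"
proof -
  \<comment> \<open>The rounded r is replaced by its upper bound 7 + log 2 n, and N by 63 n in the
    exponent and 64 n in front, which leaves an explicit function of n.\<close>
  have "eventually (\<lambda>n :: nat. 64 * real n * exp (1 - 180 * (1 / 4000000) * (63 * real n) / (7 + log 2 (real n))\<^sup>2) \<le> 1 / 8) at_top"
    by real_asymp
  then obtain n1 where n1: "\<And>n. n \<ge> n1 \<Longrightarrow>
      64 * real n * exp (1 - 180 * a * (63 * real n) / (7 + log 2 (real n))\<^sup>2) \<le> 1 / 8"
    unfolding eventually_at_top_linorder assms by blast
  have "a * (real n / ln (real n)) \<le> real q"
    if n: "n \<ge> max 16 n1" and cost: "cost_at_most (cube n) q t" and dis: "distinguishes n \<epsilon> t" and eps: "\<epsilon> \<le> 1 / 6400"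
    for n q t \<epsilon>
  proof -
    have n16: "16 \<le> n" "1 \<le> n"
      using n by auto
    define L where "L = log 2 (real n)"
    define N where "N = 64 * real n - 1"
    \<comment> \<open>This makes 2^r at least 64 n, so 4^r exceeds 8 N as required for
      \<tau>.\<close>
    define r where "r = nat \<lceil>6 + L\<rceil>"
    have L: "0 \<le> L"
      using n16 by (simp add: L_def)
    have r_bounds: "6 + L \<le> real r" "real r \<le> 7 + L"
      unfolding r_def using L by linarith+
    have r1: "1 \<le> r"
      using r_bounds L by linarith
    have N: "63 * real n \<le> N" "N \<le> 64 * real n"
      using n16 by (auto simp: N_def)
    have k: "1 \<le> n div 16" "n \<le> 32 * (n div 16)"
      using n16 by presburger+
    from general_position_exists[OF k(1) general_position_bound[OF n16(2)]]
    obtain S where S: "S \<subseteq> cube n" "card S = 64 * n" "\<forall>W\<subseteq>S. card W \<le> n div 16 \<longrightarrow> interpolable n W"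
      by (elim exE conjE) (rule that)
    from far_function_exists[OF S(1), of "4 * n", unfolded S(2), OF far_function_bound[OF n16(2)]]
    obtain f where f: "f \<in> cube n \<rightarrow>\<^sub>E {-1, 1}" "\<forall>h\<in>halfspaces n. 4 * n < card {x \<in> S. f x \<noteq> h x}"
      by (elim bexE) (rule that)
    have "a > 0"
      using assms by simp
    have "180 * a * (63 * real n) / (7 + L)\<^sup>2 \<le> 180 * a * N / (real r)\<^sup>2"
      using N r_bounds r1 L \<open>a > 0\<close> by (intro frac_le mult_left_mono power_mono) auto
    then have "N * exp (1 - 180 * a * N / (real r)\<^sup>2) \<le> 64 * real n * exp (1 - 180 * a * (63 * real n) / (7 + L)\<^sup>2)"
      using N by (intro mult_mono) auto
    then have tail: "N * exp (1 - 180 * a * N / (real r)\<^sup>2) \<le> 1 / 8"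
      using n1[of n] n unfolding L_def by linarith
    have "8 * N \<le> 4 ^ r"
    proof -
      have "64 * real n = 2 powr (6 + L)"
        using n16 by (simp add: powr_add L_def)
      also have "\<dots> \<le> 2 powr real r"
        using r_bounds by (intro powr_mono) auto
      finally have "64 * real n \<le> 2 ^ r"
        by (simp add: powr_realpow)
      moreover from this have "8 \<le> (2 :: real) ^ r"
        using n16 by linarith
      ultimately have "8 * (64 * real n) \<le> 2 ^ r * 2 ^ r"
        by (intro mult_mono) auto
      then show ?thesis
        using N by (simp add: power_mult_distrib[symmetric])
    qed
    then have q: "6 * a * N / r < real q"
      using S(3) f(2)
      by (intro distinguishes_cost_bound[OF cost dis eps S(1,2) n16(2) k(2) _ f(1) _ assms N_def r1 tail]) blast+
    have "1 \<le> ln (real n)"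
    proof -
      have "exp 1 \<le> real n"
        using exp_le n16 by linarith
      then show ?thesis
        using n16 by (subst ln_ge_iff) auto
    qed
    moreover have "L \<le> 2 * ln (real n)"
    proof -
      have "ln (real n) * 1 \<le> ln (real n) * (2 * ln 2)"
        using ln2_ge_two_thirds n16 by (intro mult_left_mono) auto
      then show ?thesis
        by (simp add: L_def log_def divide_le_eq)
    qed
    \<comment> \<open>From 7 + L with 1 \<le> ln n and L \<le> 2 ln n; the 9 cancels below against 9
      n \<le> 6 N.\<close>
    ultimately have "real r \<le> 9 * ln (real n)" "0 < ln (real n)"
      using r_bounds by linarith+
    moreover have "9 * real n \<le> 6 * N"
      using N by linarith
    ultimately have "(a * (9 * real n)) / (9 * ln (real n)) \<le> (a * (6 * N)) / real r"
      using \<open>a > 0\<close> r1 N by (intro frac_le mult_left_mono mult_nonneg_nonneg) auto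
    then show ?thesis
      using q by (simp add: mult.commute mult.left_commute)
  qed
  then show ?thesis
    by (intro exI[of _ "max 16 n1"]) auto
qed

lemma ereal_le_Inf_enat:
  assumes "\<And>m. P m \<Longrightarrow> v \<le> real m"
  shows "ereal v \<le> ereal_of_enat (Inf {enat m | m. P m})"
proof (cases "{enat m | m. P m} = {}")
  case True
  then show ?thesis
    by (simp add: Inf_enat_def)
next
  case False
  then have "Inf {enat m | m. P m} \<in> {enat m | m. P m}"
    unfolding Inf_enat_def by (auto intro: LeastI)
  then obtain m where "Inf {enat m | m. P m} = enat m" "P m"
    by blast
  then show ?thesis
    using assms by simp
qed

theorem theorem4p2:
  "\<exists>\<epsilon>\<^sub>0 c :: real. \<epsilon>\<^sub>0 > 0 \<and> c > 0 \<and>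
     (\<forall>n :: nat. \<forall>\<epsilon> :: real. n \<ge> 2 \<longrightarrow> 0 < \<epsilon> \<longrightarrow> \<epsilon> < \<epsilon>\<^sub>0 \<longrightarrow>
        ereal_of_enat (m_test (cube n) (halfspaces n) \<epsilon>) \<ge> ereal (c * (real n / ln (real n))) \<and>
        ereal_of_enat (q_test (cube n) (halfspaces n) \<epsilon>) \<ge> ereal (c * (real n / ln (real n))))"
proof -
  define a :: real where "a = 1 / 4000000"
  obtain n0 where n0: "16 \<le> n0" and large: "\<And>n q t \<epsilon>. n0 \<le> n \<Longrightarrow> cost_at_most (cube n) q t \<Longrightarrow>
      distinguishes n \<epsilon> t \<Longrightarrow> \<epsilon> \<le> 1 / 6400 \<Longrightarrow> a * (real n / ln (real n)) \<le> real q"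
    using distinguishes_cost_large[OF a_def] by blast
  \<comment> \<open>For n below n0 the quotient n / ln n is at most 2 n0, so this choice makes the
    claimed bound at most 1, which \<open>distinguishes_cost_pos\<close> supplies.\<close>
  define c where "c = min a (1 / (2 * real n0))"
  have c: "0 < c" "c \<le> a" "c \<le> 1 / (2 * real n0)"
    using n0 by (auto simp: c_def a_def)
  have bound: "c * (real n / ln (real n)) \<le> real q"
    if n: "2 \<le> n" and cost: "cost_at_most (cube n) q t" and dis: "distinguishes n \<epsilon> t" and eps: "\<epsilon> < 1 / 6400"
    for n q t \<epsilon>
  proof (cases "n0 \<le> n")
    case True
    have "c * (real n / ln (real n)) \<le> a * (real n / ln (real n))"
      using c n by (intro mult_right_mono) auto
    then show ?thesis
      using large[OF True cost dis] eps by simp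
  next
    case False
    have ln: "1 / 2 \<le> ln (real n)"
    proof -
      have "ln 2 \<le> ln (real n)"
        using n by simp
      then show ?thesis
        using ln2_ge_two_thirds by linarith
    qed
    have "real n / ln (real n) \<le> real n0 / (1 / 2)"
      using False ln by (intro frac_le) auto
    then have "c * (real n / ln (real n)) \<le> 1 / (2 * real n0) * (real n0 / (1 / 2))"
      using c ln by (intro mult_mono) auto
    also have "\<dots> = 1"
      using n0 by simp
    also have "1 \<le> real q"
      using distinguishes_cost_pos[OF cost dis n] eps by simp
    finally show ?thesis .
  qed
  show ?thesis
  proof (rule exI[of _ "1 / 6400"], rule exI[of _ c], intro conjI allI impI)
    fix n :: nat and \<epsilon> :: real
    assume n: "2 \<le> n" and "0 < \<epsilon>" and eps: "\<epsilon> < 1 / 6400"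
    show "ereal (c * (real n / ln (real n))) \<le> ereal_of_enat (m_test (cube n) (halfspaces n) \<epsilon>)"
      unfolding m_test_def
    proof (rule ereal_le_Inf_enat)
      fix m assume "\<exists>T. is_sample_tester (cube n) (halfspaces n) \<epsilon> m T"
      then obtain T where T: "is_sample_tester (cube n) (halfspaces n) \<epsilon> m T"
        by blast
      show "c * (real n / ln (real n)) \<le> real m"
        by (rule bound[OF n cost_sample_tree distinguishes_sample_tree[OF T] eps])
    qed
    show "ereal (c * (real n / ln (real n))) \<le> ereal_of_enat (q_test (cube n) (halfspaces n) \<epsilon>)"
      unfolding q_test_def
    proof (rule ereal_le_Inf_enat)
      fix q assume "\<exists>t. cost_at_most (cube n) q t \<and> is_query_tester (cube n) (halfspaces n) \<epsilon> t"
      then obtain t where t: "cost_at_most (cube n) q t" "is_query_tester (cube n) (halfspaces n) \<epsilon> t"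
        by blast
      show "c * (real n / ln (real n)) \<le> real q"
        by (rule bound[OF n t(1) distinguishes_query_tester[OF t(2)] eps])
    qed
  qed (use c(1) in simp_all)
qed

end
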